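(* Let $\mathcal{O}_1\subset(0,\pi)$, $\mathcal{O}_2\subseteq(0,\pi)$ and $\mathcal{O}_3\subset(0,\pi)$ be open sets such that $(0,\pi)\setminus\overline{\mathcal{O}_1\cup\mathcal{O}_3}$ is a nonempty open subset of $(0,\pi)$. Then the control system $$\begin{cases}\partial_t\rho+\rho_s\partial_x u=\mathbf{1}_{\mathcal{O}_1}f_1 & \text{in }(0,T)\times(0,\pi),\\ \partial_t u+a\gamma\rho_s^{\gamma-2}\partial_x\rho-\frac1{\rho_s}\partial_x S=\mathbf{1}_{\mathcal{O}_2}f_2 & \text{in }(0,T)\times(0,\pi),\\ \partial_t S+\frac1\kappa S-\frac\mu\kappa\partial_x u=\mathbf{1}_{\mathcal{O}_3}f_3 & \text{in }(0,T)\times(0,\pi),\\ u(t,0)=u(t,\pi)=0 & t\in(0,T),\\ \rho(0)=\rho_0,\ u(0)=u_0,\ S(0)=S_0 & \text{in }(0,\pi)\end{cases}$$ is not null controllable in $(L^2(0,\pi))^3$ at any time $T>0$ by interior controls $f_1,f_2,f_3\in L^2(0,T;L^2(0,\pi))$ supported in $\mathcal{O}_1,\mathcal{O}_2,\mathcal{O}_3$ respectively.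
   Context: The constants satisfy $a>0$, $\gamma\ge1$, $\rho_s>0$, $\mu>0$, $\kappa>0$. $\mathbf 1_{\mathcal{O}}$ is the characteristic function of $\mathcal{O}$; function spaces are complex-valued. Put $b=a\gamma\rho_s^{\gamma-2}$. Solutions are understood as mild solutions $z=(\rho,u,S)^\top\in C([0,T];(L^2(0,\pi))^3)$ of $\dot z=\mathcal{A}z+(\mathbf 1_{\mathcal{O}_1}f_1,\mathbf 1_{\mathcal{O}_2}f_2,\mathbf 1_{\mathcal{O}_3}f_3)^\top$, where $\mathcal{A}(\rho,u,S)^\top=(-\rho_s u',\,-b\rho'+\frac1{\rho_s}S',\,\frac\mu\kappa u'-\frac1\kappa S)^\top$ with domain $\{(\rho,u,S)\in(L^2(0,\pi))^3: u\in H^1_0(0,\pi),\ -b\rho+\frac1{\rho_s}S\in H^1(0,\pi)\}$ ($\mathcal{A}$ generates a strongly continuous semigroup on $(L^2(0,\pi))^3$). The system is null controllable in $(L^2(0,\pi))^3$ at time $T>0$ if for every $(\rho_0,u_0,S_0)^\top\in(L^2(0,\pi))^3$ there exist controls $f_i\in L^2(0,T;L^2(\mathcal{O}_i))$, $i=1,2,3$, such that the corresponding solution satisfies $(\rho,u,S)^\top(T,\cdot)=(0,0,0)^\top$ in $(0,\pi)$. *)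

theory Defs
  imports "HOL-Analysis.Analysis"
begin

section \<open>The complex Hilbert space of square-integrable functions on the interval\<close>

abbreviation Om :: "real set" where "Om \<equiv> {0<..<pi}"

abbreviation lebOm :: "real measure" where "lebOm \<equiv> lebesgue_on Om"

definition square_integrable :: "(real \<Rightarrow> complex) \<Rightarrow> bool" where
  "square_integrable f \<longleftrightarrow>
     f \<in> borel_measurable lebOm \<and> integrable lebOm (\<lambda>x. (cmod (f x))\<^sup>2)"

lemma finite_measure_lebOm: "finite_measure lebOm"
  by (rule finite_measureI) (simp add: emeasure_restrict_space)

lemma square_integrable_bound:
  assumes "square_integrable g" "f \<in> borel_measurable lebOm"
    and "AE x in lebOm. cmod (f x) \<le> cmod (g x)"
  shows "square_integrable f"
  unfolding square_integrable_def
proof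
  show "integrable lebOm (\<lambda>x. (cmod (f x))\<^sup>2)"
    apply (rule Bochner_Integration.integrable_bound[of _ "\<lambda>x. (cmod (g x))\<^sup>2"])
    using assms by (auto simp: square_integrable_def intro!: power_mono elim!: eventually_mono)
qed (use assms in auto)

lemma square_integrable_add:
  assumes "square_integrable f" "square_integrable g"
  shows "square_integrable (\<lambda>x. f x + g x)"
  unfolding square_integrable_def
proof
  show "integrable lebOm (\<lambda>x. (cmod (f x + g x))\<^sup>2)"
  proof (rule Bochner_Integration.integrable_bound[of _ "\<lambda>x. 2 * (cmod (f x))\<^sup>2 + 2 * (cmod (g x))\<^sup>2"])
    have "(cmod (f x + g x))\<^sup>2 \<le> 2 * (cmod (f x))\<^sup>2 + 2 * (cmod (g x))\<^sup>2" for x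
    proof -
      have "(cmod (f x + g x))\<^sup>2 \<le> (cmod (f x) + cmod (g x))\<^sup>2"
        by (intro power_mono norm_triangle_ineq) auto
      also have "\<dots> \<le> 2 * (cmod (f x))\<^sup>2 + 2 * (cmod (g x))\<^sup>2"
        using sum_squares_ge_zero[of "cmod (f x) - cmod (g x)" 0]
        by (simp add: power2_eq_square algebra_simps)
      finally show ?thesis .
    qed
    then show "AE x in lebOm. norm ((cmod (f x + g x))\<^sup>2)
        \<le> norm (2 * (cmod (f x))\<^sup>2 + 2 * (cmod (g x))\<^sup>2)"
      by auto
  qed (use assms in \<open>auto simp: square_integrable_def\<close>)
qed (use assms in \<open>auto simp: square_integrable_def\<close>)

lemma square_integrable_cmult:
  assumes "square_integrable f"
  shows "square_integrable (\<lambda>x. c * f x)"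
  using assms by (auto simp: square_integrable_def norm_mult power_mult_distrib)

lemma square_integrable_const: "square_integrable (\<lambda>x. c)"
  using finite_measure.integrable_const[OF finite_measure_lebOm]
  by (auto simp: square_integrable_def)

lemma square_integrable_bounded:
  assumes "f \<in> borel_measurable lebOm" "\<And>x. cmod (f x) \<le> B"
  shows "square_integrable f"
proof (rule square_integrable_bound[OF square_integrable_const[of "complex_of_real B"] assms(1)])
  have "cmod (f x) \<le> \<bar>B\<bar>" for x
    using assms(2)[of x] by linarith
  then show "AE x in lebOm. cmod (f x) \<le> cmod (complex_of_real B)"
    by auto
qed

quotient_type L2 = "real \<Rightarrow> complex" / partial:
  "\<lambda>f g. square_integrable f \<and> square_integrable g \<and> (AE x in lebOm. f x = g x)"
proof (rule part_equivpI)
  show "\<exists>f. square_integrable f \<and> square_integrable f \<and> (AE x in lebOm. f x = f x)"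
    using square_integrable_const by blast
next
  show "symp (\<lambda>f g. square_integrable f \<and> square_integrable g \<and> (AE x in lebOm. f x = g x))"
    by (rule sympI) (auto elim!: eventually_mono)
next
  show "transp (\<lambda>f g. square_integrable f \<and> square_integrable g \<and> (AE x in lebOm. f x = g x))"
    by (rule transpI) (auto elim!: eventually_elim2)
qed

lemma square_integrable_rep [simp]: "square_integrable (rep_L2 f)"
  using Quotient3_rep_reflp[OF Quotient3_L2] by blast

lemma abs_rep_L2 [simp]: "abs_L2 (rep_L2 f) = f"
  by (rule Quotient3_abs_rep[OF Quotient3_L2])

lemma rep_abs_L2:
  assumes "square_integrable f"
  shows "AE x in lebOm. rep_L2 (abs_L2 f) x = f x"
proof -
  have "square_integrable (rep_L2 (abs_L2 f)) \<and> square_integrable f \<and>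
      (AE x in lebOm. rep_L2 (abs_L2 f) x = f x)"
    by (rule Quotient3_rep_abs[OF Quotient3_L2]) (use assms in auto)
  then show ?thesis by blast
qed

lemma abs_L2_eq_iff:
  assumes "square_integrable f" "square_integrable g"
  shows "abs_L2 f = abs_L2 g \<longleftrightarrow> (AE x in lebOm. f x = g x)"
  using Quotient3_rel[OF Quotient3_L2, of f g] assms by auto

lemma integrable_mult_square:
  assumes "square_integrable f" "square_integrable g"
  shows "integrable lebOm (\<lambda>x. f x * g x)"
proof (rule Bochner_Integration.integrable_bound[of _ "\<lambda>x. (cmod (f x))\<^sup>2 + (cmod (g x))\<^sup>2"])
  have "cmod (f x) * cmod (g x) \<le> (cmod (f x))\<^sup>2 + (cmod (g x))\<^sup>2" for x
    using sum_squares_bound[of "cmod (f x)" "cmod (g x)"]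
      mult_nonneg_nonneg[OF norm_ge_zero[of "f x"] norm_ge_zero[of "g x"]]
    unfolding mult.assoc by linarith
  then show "AE x in lebOm. norm (f x * g x) \<le> norm ((cmod (f x))\<^sup>2 + (cmod (g x))\<^sup>2)"
    by (auto simp: norm_mult)
qed (use assms in \<open>auto simp: square_integrable_def\<close>)

lemma integrable_inner_square:
  assumes "square_integrable f" "square_integrable g"
  shows "integrable lebOm (\<lambda>x. f x \<bullet> g x)"
proof -
  have "square_integrable (\<lambda>x. cnj (g x))"
    using assms(2) borel_measurable_continuous_onI[of cnj] measurable_compose[of g lebOm borel cnj borel]
    by (auto simp: square_integrable_def intro: continuous_intros)
  from integrable_mult_square[OF assms(1) this]
  have "integrable lebOm (\<lambda>x. Re (f x * cnj (g x)))"
    by (rule integrable_Re)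
  then show ?thesis
    by (simp add: inner_complex_def)
qed

instantiation L2 :: real_inner
begin

lift_definition zero_L2 :: L2 is "\<lambda>x. 0"
  by (auto simp: square_integrable_const)

lift_definition plus_L2 :: "L2 \<Rightarrow> L2 \<Rightarrow> L2" is "\<lambda>f g x. f x + g x"
  by (auto intro!: square_integrable_add)

lift_definition uminus_L2 :: "L2 \<Rightarrow> L2" is "\<lambda>f x. - f x"
  by (auto simp: square_integrable_def)

definition minus_L2 :: "L2 \<Rightarrow> L2 \<Rightarrow> L2" where "minus_L2 f g = f + - g"

lift_definition scaleR_L2 :: "real \<Rightarrow> L2 \<Rightarrow> L2" is "\<lambda>r f x. r *\<^sub>R f x"
  using square_integrable_cmult by (auto simp: scaleR_conv_of_real)

lift_definition inner_L2 :: "L2 \<Rightarrow> L2 \<Rightarrow> real" is "\<lambda>f g. LINT x|lebOm. f x \<bullet> g x"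
proof (elim conjE)
  fix f f' g g' :: "real \<Rightarrow> complex"
  assume *: "square_integrable f" "square_integrable f'" "square_integrable g" "square_integrable g'"
    "AE x in lebOm. f x = f' x" "AE x in lebOm. g x = g' x"
  show "(LINT x|lebOm. f x \<bullet> g x) = (LINT x|lebOm. f' x \<bullet> g' x)"
  proof (rule integral_cong_AE)
    show "AE x in lebOm. f x \<bullet> g x = f' x \<bullet> g' x"
      using *(5,6) by eventually_elim simp
  qed (use *(1-4) in \<open>auto simp: square_integrable_def\<close>)
qed

definition norm_L2 :: "L2 \<Rightarrow> real" where "norm_L2 f = sqrt (f \<bullet> f)"

definition sgn_L2 :: "L2 \<Rightarrow> L2" where "sgn_L2 f = inverse (norm f) *\<^sub>R f"

definition dist_L2 :: "L2 \<Rightarrow> L2 \<Rightarrow> real" where "dist_L2 f g = norm (f - g)"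

definition uniformity_L2 :: "(L2 \<times> L2) filter" where
  "uniformity_L2 = (INF e\<in>{0<..}. principal {(f, g). dist f g < e})"

definition open_L2 :: "L2 set \<Rightarrow> bool" where
  "open_L2 U \<longleftrightarrow> (\<forall>f\<in>U. \<forall>\<^sub>F (f', g) in uniformity. f' = f \<longrightarrow> g \<in> U)"

instance
proof
  fix f g h :: L2 and r s :: real and U :: "L2 set"
  show "f + g + h = f + (g + h)"
    by transfer (auto intro!: square_integrable_add simp: add.assoc)
  show "f + g = g + f"
    by transfer (auto intro!: square_integrable_add simp: add.commute)
  show "0 + f = f"
    by transfer auto
  show "- f + f = 0"
    by transfer (auto simp: square_integrable_const)
  show "f - g = f + - g"
    by (rule minus_L2_def)
  show "r *\<^sub>R (f + g) = r *\<^sub>R f + r *\<^sub>R g"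
    apply transfer
    subgoal for r f g
      using square_integrable_cmult[OF square_integrable_add[of f g], of "of_real r"]
        square_integrable_add[of "\<lambda>x. of_real r * f x" "\<lambda>x. of_real r * g x"]
        square_integrable_cmult[of f "of_real r"] square_integrable_cmult[of g "of_real r"]
      by (simp add: scaleR_conv_of_real distrib_left)
    done
  show "(r + s) *\<^sub>R f = r *\<^sub>R f + s *\<^sub>R f"
    apply transfer
    subgoal for r s f
      using square_integrable_add[of "\<lambda>x. of_real r * f x" "\<lambda>x. of_real s * f x"]
        square_integrable_cmult[of f "of_real r"] square_integrable_cmult[of f "of_real s"]
      by (simp add: scaleR_conv_of_real distrib_right)
    done
  show "r *\<^sub>R s *\<^sub>R f = (r * s) *\<^sub>R f"
    apply transfer
    subgoal for r s f
      using square_integrable_cmult[of f "of_real (r * s)"]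
      by (auto simp: scaleR_conv_of_real mult.assoc)
    done
  show "1 *\<^sub>R f = f"
    by transfer auto
  show "sgn f = inverse (norm f) *\<^sub>R f"
    by (rule sgn_L2_def)
  show "dist f g = norm (f - g)"
    by (rule dist_L2_def)
  show "uniformity = (INF e\<in>{0<..}. principal {(f, g). dist (f::L2) g < e})"
    by (rule uniformity_L2_def)
  show "open U \<longleftrightarrow> (\<forall>f\<in>U. \<forall>\<^sub>F (f', g) in uniformity. f' = f \<longrightarrow> g \<in> U)"
    by (rule open_L2_def)
  show "f \<bullet> g = g \<bullet> f"
    by transfer (auto simp: inner_commute)
  show "(f + g) \<bullet> h = f \<bullet> h + g \<bullet> h"
    by transfer (simp add: inner_add_left integrable_inner_square)
  show "r *\<^sub>R f \<bullet> g = r * (f \<bullet> g)"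
    by transfer simp
  show "0 \<le> f \<bullet> f"
    by transfer simp
  show "f \<bullet> f = 0 \<longleftrightarrow> f = 0"
    apply transfer
    subgoal for f
      using integral_nonneg_eq_0_iff_AE[OF integrable_inner_square[of f f]]
      by (auto simp: square_integrable_const)
    done
  show "norm f = sqrt (f \<bullet> f)"
    by (rule norm_L2_def)
qed

end

lemma abs_L2_add:
  assumes "square_integrable f" "square_integrable g"
  shows "abs_L2 f + abs_L2 g = abs_L2 (\<lambda>x. f x + g x)"
  using assms by (intro plus_L2.abs_eq) auto

lemma abs_L2_scaleR:
  assumes "square_integrable f"
  shows "r *\<^sub>R abs_L2 f = abs_L2 (\<lambda>x. r *\<^sub>R f x)"
  using assms by (intro scaleR_L2.abs_eq) auto

lemma abs_L2_diff:
  assumes "square_integrable f" "square_integrable g"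
  shows "abs_L2 f - abs_L2 g = abs_L2 (\<lambda>x. f x - g x)"
proof -
  have "- abs_L2 g = abs_L2 (\<lambda>x. - g x)"
    using assms by (intro uminus_L2.abs_eq) auto
  moreover have "square_integrable (\<lambda>x. - g x)"
    using assms by (auto simp: square_integrable_def)
  ultimately show ?thesis
    using abs_L2_add[OF assms(1), of "\<lambda>x. - g x"] by (simp add: minus_L2_def)
qed

lemma norm_abs_L2:
  assumes "square_integrable f"
  shows "norm (abs_L2 f) = sqrt (LINT x|lebOm. (cmod (f x))\<^sup>2)"
proof -
  have "abs_L2 f \<bullet> abs_L2 f = (LINT x|lebOm. f x \<bullet> f x)"
    using assms by (intro inner_L2.abs_eq) auto
  then show ?thesis
    by (simp add: norm_L2_def power2_norm_eq_inner)
qed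

lemma norm_L2_rep: "norm f = sqrt (LINT x|lebOm. (cmod (rep_L2 f x))\<^sup>2)"
  using norm_abs_L2[of "rep_L2 f"] by simp

lemma abs_L2_tendsto:
  assumes g: "square_integrable g"
    and f: "\<And>n. f n \<in> borel_measurable lebOm" and l: "l \<in> borel_measurable lebOm"
    and bd: "\<And>n. AE x in lebOm. cmod (f n x) \<le> cmod (g x)"
    and lim: "AE x in lebOm. (\<lambda>n. f n x) \<longlonglongrightarrow> l x"
  shows "square_integrable l" "(\<lambda>n. abs_L2 (f n)) \<longlonglongrightarrow> abs_L2 l"
proof -
  have bd': "AE x in lebOm. \<forall>n. cmod (f n x) \<le> cmod (g x)"
    using bd by (simp add: AE_all_countable)
  have lbd: "AE x in lebOm. cmod (l x) \<le> cmod (g x)"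
    using bd' lim
  proof eventually_elim
    case (elim x)
    then show ?case
      by (intro LIMSEQ_le_const2[OF tendsto_norm[OF elim(2)]]) auto
  qed
  show l2: "square_integrable l"
    by (rule square_integrable_bound[OF g l lbd])
  have f2: "square_integrable (f n)" for n
    by (rule square_integrable_bound[OF g f bd])
  have "(\<lambda>n. LINT x|lebOm. (cmod (f n x - l x))\<^sup>2) \<longlonglongrightarrow> (LINT x|lebOm. 0)"
  proof (rule integral_dominated_convergence[where w = "\<lambda>x. 4 * (cmod (g x))\<^sup>2"])
    show "AE x in lebOm. (\<lambda>n. (cmod (f n x - l x))\<^sup>2) \<longlonglongrightarrow> 0"
      using lim
    proof eventually_elim
      case (elim x)
      then have "(\<lambda>n. (cmod (f n x - l x))\<^sup>2) \<longlonglongrightarrow> (cmod (l x - l x))\<^sup>2"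
        by (intro tendsto_intros)
      then show ?case by simp
    qed
    show "AE x in lebOm. norm ((cmod (f n x - l x))\<^sup>2) \<le> 4 * (cmod (g x))\<^sup>2" for n
      using bd' lbd
    proof eventually_elim
      case (elim x)
      have "cmod (f n x - l x) \<le> 2 * cmod (g x)"
        using norm_triangle_ineq4[of "f n x" "l x"] elim(1)[rule_format, of n] elim(2) by linarith
      then have "(cmod (f n x - l x))\<^sup>2 \<le> (2 * cmod (g x))\<^sup>2"
        by (intro power_mono) auto
      then show ?case by (simp add: power_mult_distrib)
    qed
  qed (use g f l in \<open>auto simp: square_integrable_def\<close>)
  then have "(\<lambda>n. sqrt (LINT x|lebOm. (cmod (f n x - l x))\<^sup>2)) \<longlonglongrightarrow> sqrt 0"
    by (intro tendsto_real_sqrt) simp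
  moreover have "norm (abs_L2 (f n) - abs_L2 l) = sqrt (LINT x|lebOm. (cmod (f n x - l x))\<^sup>2)" for n
    unfolding abs_L2_diff[OF f2 l2]
    by (rule norm_abs_L2) (use square_integrable_add[OF f2 square_integrable_cmult[OF l2, of "-1"]] in simp)
  ultimately have "(\<lambda>n. norm (abs_L2 (f n) - abs_L2 l)) \<longlonglongrightarrow> 0"
    by simp
  then show "(\<lambda>n. abs_L2 (f n)) \<longlonglongrightarrow> abs_L2 l"
    by (simp add: tendsto_norm_zero_iff LIM_zero_iff)
qed

lemma integral_norm_le_norm_L2:
  assumes "square_integrable h"
  shows "(LINT x|lebOm. cmod (h x)) \<le> sqrt pi * norm (abs_L2 h)"
proof -
  let ?a = "\<lambda>x. complex_of_real (cmod (h x))"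
  have a: "square_integrable ?a"
    using assms by (auto simp: square_integrable_def)
  have "abs_L2 ?a \<bullet> abs_L2 (\<lambda>x. 1) = (LINT x|lebOm. ?a x \<bullet> 1)"
    by (rule inner_L2.abs_eq) (use a square_integrable_const in auto)
  also have "\<dots> = (LINT x|lebOm. cmod (h x))"
    by (simp add: inner_complex_def)
  finally have "(LINT x|lebOm. cmod (h x)) \<le> norm (abs_L2 ?a) * norm (abs_L2 (\<lambda>x. 1))"
    using norm_cauchy_schwarz[of "abs_L2 ?a" "abs_L2 (\<lambda>x. 1)"] by simp
  also have "norm (abs_L2 (\<lambda>x. 1)) = sqrt pi"
    unfolding norm_abs_L2[OF square_integrable_const]
    by (simp add: measure_restrict_space)
  also have "norm (abs_L2 ?a) = norm (abs_L2 h)"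
    unfolding norm_abs_L2[OF a] norm_abs_L2[OF assms] by simp
  finally show ?thesis by (simp add: mult.commute)
qed

instance L2 :: complete_space
proof
  fix X :: "nat \<Rightarrow> L2"
  assume X: "Cauchy X"
  have "\<exists>r. \<forall>k. (\<forall>m\<ge>r k. \<forall>n\<ge>r k. dist (X m) (X n) < (1/2)^k) \<and> r k < (r (Suc k) :: nat)"
  proof (rule dependent_nat_choice)
    show "\<exists>N. \<forall>m\<ge>N. \<forall>n\<ge>N. dist (X m) (X n) < (1/2)^0"
      using X unfolding Cauchy_def by (auto dest!: spec[of _ 1])
  next
    fix N k :: nat
    obtain M where M: "\<forall>m\<ge>M. \<forall>n\<ge>M. dist (X m) (X n) < (1/2)^Suc k"
      using X unfolding Cauchy_def by (meson half_gt_zero_iff zero_less_numeral zero_less_one zero_less_power zero_less_divide_iff)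
    then show "\<exists>M. (\<forall>m\<ge>M. \<forall>n\<ge>M. dist (X m) (X n) < (1/2)^Suc k) \<and> N < M"
      by (intro exI[of _ "max M (Suc N)"]) auto
  qed
  then obtain r where r: "\<And>k m n. m \<ge> r k \<Longrightarrow> n \<ge> r k \<Longrightarrow> dist (X m) (X n) < (1/2)^k"
    and r_less: "\<And>k. r k < (r (Suc k) :: nat)"
    by blast
  have r_mono: "strict_mono r"
    using r_less by (simp add: strict_mono_Suc_iff)
  define f where "f k = rep_L2 (X (r k))" for k
  have f2: "square_integrable (f k)" for k
    by (simp add: f_def)
  have fm [measurable]: "f k \<in> borel_measurable lebOm" for k
    using f2[of k] by (simp add: square_integrable_def)
  have f2d: "square_integrable (\<lambda>x. f k x - f l x)" for k l
    using square_integrable_add[OF f2[of k] square_integrable_cmult[OF f2[of l], of "-1"]] by simp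
  have fd: "abs_L2 (\<lambda>x. f k x - f l x) = X (r k) - X (r l)" for k l
    using abs_L2_diff[OF f2[of k] f2[of l]] by (simp add: f_def)
  have fdist: "norm (abs_L2 (\<lambda>x. f k x - f l x)) \<le> (1/2)^l" if "l \<le> k" for k l
    using r[of l "r k" "r l"] that strict_mono_less_eq[OF r_mono, of l k]
    by (simp add: fd dist_norm)
  have "(\<integral>\<^sup>+x. (\<Sum>k. ennreal (cmod (f (Suc k) x - f k x))) \<partial>lebOm)
      = (\<Sum>k. \<integral>\<^sup>+x. ennreal (cmod (f (Suc k) x - f k x)) \<partial>lebOm)"
    by (rule nn_integral_suminf) simp
  also have "\<dots> \<le> (\<Sum>k. ennreal (sqrt pi * (1/2)^k))"
  proof (rule suminf_le)
    fix k
    have "integrable lebOm (\<lambda>x. cmod (f (Suc k) x - f k x))"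
      using integrable_mult_square[OF f2d[of "Suc k" k] square_integrable_const[of 1]]
      by (intro integrable_norm) simp
    then have "(\<integral>\<^sup>+x. ennreal (cmod (f (Suc k) x - f k x)) \<partial>lebOm)
        = ennreal (LINT x|lebOm. cmod (f (Suc k) x - f k x))"
      by (intro nn_integral_eq_integral) auto
    also have "\<dots> \<le> ennreal (sqrt pi * (1/2)^k)"
      using integral_norm_le_norm_L2[OF f2d[of "Suc k" k]] fdist[of k "Suc k"]
      by (intro ennreal_leI order_trans[OF integral_norm_le_norm_L2[OF f2d]] mult_left_mono) auto
    finally show "(\<integral>\<^sup>+x. ennreal (cmod (f (Suc k) x - f k x)) \<partial>lebOm) \<le> ennreal (sqrt pi * (1/2)^k)" .
  qed auto
  also have "\<dots> = ennreal (\<Sum>k. sqrt pi * (1/2)^k)"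
    by (rule suminf_ennreal2) (auto intro!: summable_mult summable_geometric)
  also have "\<dots> < \<infinity>" by simp
  finally have "AE x in lebOm. (\<Sum>k. ennreal (cmod (f (Suc k) x - f k x))) \<noteq> \<infinity>"
    by (intro nn_integral_noteq_infinite) auto
  then have conv: "AE x in lebOm. convergent (\<lambda>k. f k x)"
  proof eventually_elim
    case (elim x)
    then have "summable (\<lambda>k. cmod (f (Suc k) x - f k x))"
      by (intro summable_suminf_not_top) auto
    then have "summable (\<lambda>k. f (Suc k) x - f k x)"
      by (rule summable_norm_cancel)
    then have "convergent (\<lambda>n. \<Sum>k<n. (f (Suc k) x - f k x))"
      by (simp add: summable_iff_convergent)
    then have "convergent (\<lambda>n. f n x - f 0 x)"
      by (simp only: sum_lessThan_telescope[of "\<lambda>k. f k x"])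
    then have "convergent (\<lambda>n. (f n x - f 0 x) + f 0 x)"
      by (intro convergent_add convergent_const)
    then show ?case by simp
  qed
  define g where "g x = lim (\<lambda>k. f k x)" for x
  have gm [measurable]: "g \<in> borel_measurable lebOm"
    unfolding g_def by (rule borel_measurable_lim_metric) simp
  have lim: "AE x in lebOm. (\<lambda>k. f k x) \<longlonglongrightarrow> g x"
    using conv by eventually_elim (simp add: g_def convergent_LIMSEQ_iff)
  have fatou: "(\<integral>\<^sup>+x. ennreal ((cmod (g x - f k x))\<^sup>2) \<partial>lebOm) \<le> ennreal (((1/2)^k)\<^sup>2)" for k
  proof -
    have "(\<integral>\<^sup>+x. ennreal ((cmod (g x - f k x))\<^sup>2) \<partial>lebOm)
        = (\<integral>\<^sup>+x. liminf (\<lambda>m. ennreal ((cmod (f m x - f k x))\<^sup>2)) \<partial>lebOm)"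
    proof (rule nn_integral_cong_AE, use lim in eventually_elim)
      case (elim x)
      have "(\<lambda>m. ennreal ((cmod (f m x - f k x))\<^sup>2)) \<longlonglongrightarrow> ennreal ((cmod (g x - f k x))\<^sup>2)"
        by (intro tendsto_intros elim)
      then show ?case
        by (intro lim_imp_Liminf[symmetric]) auto
    qed
    also have "\<dots> \<le> liminf (\<lambda>m. \<integral>\<^sup>+x. ennreal ((cmod (f m x - f k x))\<^sup>2) \<partial>lebOm)"
      by (rule nn_integral_liminf) simp
    also have "\<dots> \<le> liminf (\<lambda>m. ennreal (((1/2)^k)\<^sup>2))"
    proof (rule Liminf_mono, rule eventually_sequentiallyI)
      fix m assume m: "k \<le> m"
      have "(\<integral>\<^sup>+x. ennreal ((cmod (f m x - f k x))\<^sup>2) \<partial>lebOm)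
          = ennreal (LINT x|lebOm. (cmod (f m x - f k x))\<^sup>2)"
        using f2d[of m k] by (intro nn_integral_eq_integral) (auto simp: square_integrable_def)
      also have "(LINT x|lebOm. (cmod (f m x - f k x))\<^sup>2) = (norm (abs_L2 (\<lambda>x. f m x - f k x)))\<^sup>2"
        unfolding norm_abs_L2[OF f2d] by (simp add: integral_nonneg_AE)
      also have "ennreal \<dots> \<le> ennreal (((1/2)^k)\<^sup>2)"
        by (intro ennreal_leI power_mono fdist m) auto
      finally show "(\<integral>\<^sup>+x. ennreal ((cmod (f m x - f k x))\<^sup>2) \<partial>lebOm) \<le> ennreal (((1/2)^k)\<^sup>2)" .
    qed
    also have "\<dots> = ennreal (((1/2)^k)\<^sup>2)"
      by (simp add: Liminf_const)
    finally show ?thesis .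
  qed
  have gfd: "square_integrable (\<lambda>x. g x - f k x)" for k
    unfolding square_integrable_def
  proof
    show "integrable lebOm (\<lambda>x. (cmod (g x - f k x))\<^sup>2)"
      using order_le_less_trans[OF fatou[of k] ennreal_less_top]
      by (intro integrableI_nonneg) auto
  qed simp
  have g2: "square_integrable g"
    using square_integrable_add[OF gfd[of 0] f2[of 0]] by simp
  have gnorm: "norm (abs_L2 g - X (r k)) \<le> (1/2)^k" for k
  proof -
    have "abs_L2 g - X (r k) = abs_L2 (\<lambda>x. g x - f k x)"
      using abs_L2_diff[OF g2 f2[of k]] by (simp add: f_def)
    then have "norm (abs_L2 g - X (r k)) = sqrt (LINT x|lebOm. (cmod (g x - f k x))\<^sup>2)"
      by (simp add: norm_abs_L2[OF gfd])
    also have "\<dots> \<le> sqrt (((1/2)^k)\<^sup>2)"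
    proof (rule real_sqrt_le_mono)
      have "ennreal (LINT x|lebOm. (cmod (g x - f k x))\<^sup>2) \<le> ennreal (((1/2)^k)\<^sup>2)"
        using fatou[of k] gfd[of k]
        by (subst nn_integral_eq_integral[symmetric]) (auto simp: square_integrable_def)
      then show "(LINT x|lebOm. (cmod (g x - f k x))\<^sup>2) \<le> ((1/2)^k)\<^sup>2"
        by (subst (asm) ennreal_le_iff) auto
    qed
    finally show ?thesis by simp
  qed
  have "(\<lambda>k. X (r k)) \<longlonglongrightarrow> abs_L2 g"
  proof (rule LIM_zero_cancel, rule Lim_null_comparison)
    show "\<forall>\<^sub>F k in sequentially. norm (X (r k) - abs_L2 g) \<le> (1/2)^k"
      using gnorm by (simp add: norm_minus_commute)
    show "(\<lambda>k. (1/2::real)^k) \<longlonglongrightarrow> 0"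
      by (rule LIMSEQ_power_zero) simp
  qed
  then have "X \<longlonglongrightarrow> abs_L2 g"
    using Cauchy_converges_subseq[OF X r_mono] by (simp add: o_def)
  then show "convergent X"
    by (rule convergentI)
qed

instance L2 :: banach ..

lemma second_countable_from_dense:
  fixes D :: "'a::metric_space set"
  assumes D: "countable D" "\<And>x e. 0 < e \<Longrightarrow> \<exists>d\<in>D. dist x d < e"
  shows "\<exists>B::'a set set. countable B \<and> open = generate_topology B"
proof -
  define B where "B = (\<lambda>(d, n::nat). ball d (1 / Suc n)) ` (D \<times> UNIV)"
  have "topological_basis B"
  proof (rule topological_basisI)
    show "open b" if "b \<in> B" for b
      using that by (auto simp: B_def)
    fix U :: "'a set" and x assume "open U" "x \<in> U"
    then obtain e where e: "0 < e" "ball x e \<subseteq> U"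
      by (meson open_contains_ball)
    then obtain n where n: "1 / real (Suc n) < e / 2"
      using nat_approx_posE[of "e/2"] by auto
    obtain d where d: "d \<in> D" "dist x d < 1 / real (Suc n)"
      using D(2)[of "1 / real (Suc n)" x] by auto
    have "ball d (1 / real (Suc n)) \<subseteq> ball x e"
    proof
      fix y assume "y \<in> ball d (1 / real (Suc n))"
      then show "y \<in> ball x e"
        using dist_triangle[of x y d] d n by simp
    qed
    then show "\<exists>b\<in>B. x \<in> b \<and> b \<subseteq> U"
      using e d by (intro bexI[of _ "ball d (1 / real (Suc n))"])
        (auto simp: B_def dist_commute intro!: image_eqI[of _ _ "(d, n)"])
  qed
  moreover have "countable B"
    unfolding B_def using D(1) by auto
  ultimately show ?thesis
    using topological_basis_imp_subbasis by blast
qed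

lemma countable_dense_in_span:
  fixes C :: "'a::real_normed_vector set"
  assumes C: "countable C"
  shows "\<exists>D. countable D \<and> span C \<subseteq> closure D"
proof -
  define D where "D = (\<lambda>l. \<Sum>p\<leftarrow>l. fst p *\<^sub>R snd p) ` lists (\<rat> \<times> C)"
  have "countable D"
    unfolding D_def using C by (intro countable_image countable_lists) (auto simp: countable_rat)
  moreover have "span C \<subseteq> closure D"
  proof (rule span_minimal)
    show "C \<subseteq> closure D"
    proof
      fix c assume "c \<in> C"
      then have "c \<in> D"
        unfolding D_def by (intro image_eqI[of _ _ "[(1, c)]"]) auto
      then show "c \<in> closure D"
        using closure_subset by blast
    qed
    have add: "x + y \<in> D" if xy: "x \<in> D" "y \<in> D" for x y
    proof -
      from xy obtain k l where "x = (\<Sum>p\<leftarrow>k. fst p *\<^sub>R snd p)" "k \<in> lists (\<rat> \<times> C)"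
        "y = (\<Sum>p\<leftarrow>l. fst p *\<^sub>R snd p)" "l \<in> lists (\<rat> \<times> C)"
        unfolding D_def by blast
      then show ?thesis
        unfolding D_def by (intro image_eqI[of _ _ "k @ l"]) auto
    qed
    have mult: "q *\<^sub>R x \<in> D" if qx: "q \<in> \<rat>" "x \<in> D" for q x
    proof -
      from qx obtain k where k: "x = (\<Sum>p\<leftarrow>k. fst p *\<^sub>R snd p)" "k \<in> lists (\<rat> \<times> C)"
        unfolding D_def by blast
      have "q *\<^sub>R (\<Sum>p\<leftarrow>k. fst p *\<^sub>R snd p) = (\<Sum>p\<leftarrow>map (\<lambda>p. (q * fst p, snd p)) k. fst p *\<^sub>R snd p)"
        by (induction k) (auto simp: scaleR_add_right)
      moreover have "map (\<lambda>p. (q * fst p, snd p)) k \<in> lists (\<rat> \<times> C)"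
        using k(2) qx(1) by (induction k) auto
      ultimately show ?thesis
        unfolding D_def k(1) by blast
    qed
    show "subspace (closure D)"
      unfolding subspace_def
    proof (intro conjI ballI allI)
      have "0 \<in> D"
        unfolding D_def by (intro image_eqI[of _ _ "[]"]) auto
      then show "0 \<in> closure D"
        using closure_subset by blast
    next
      fix x y assume "x \<in> closure D" "y \<in> closure D"
      then obtain f g where "\<And>n::nat. f n \<in> D" "f \<longlonglongrightarrow> x" "\<And>n::nat. g n \<in> D" "g \<longlonglongrightarrow> y"
        unfolding closure_sequential by blast
      then show "x + y \<in> closure D"
        unfolding closure_sequential
        by (intro exI[of _ "\<lambda>n. f n + g n"]) (auto intro: add tendsto_add)
    next
      fix c :: real and x assume "x \<in> closure D"
      then obtain f where f: "\<And>n::nat. f n \<in> D" "f \<longlonglongrightarrow> x"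
        unfolding closure_sequential by blast
      have "c \<in> closure \<rat>"
        unfolding closure_approachable
      proof (intro allI impI)
        fix e :: real assume "0 < e"
        then obtain q where "q \<in> \<rat>" "c < q" "q < c + e"
          using Rats_dense_in_real[of c "c + e"] by auto
        then show "\<exists>q\<in>\<rat>. dist q c < e"
          by (intro bexI[of _ q]) (auto simp: dist_real_def)
      qed
      then obtain q where q: "\<And>n::nat. q n \<in> \<rat>" "q \<longlonglongrightarrow> c"
        unfolding closure_sequential by blast
      show "c *\<^sub>R x \<in> closure D"
        unfolding closure_sequential
        by (intro exI[of _ "\<lambda>n. q n *\<^sub>R f n"]) (auto intro!: mult tendsto_scaleR f q)
    qed
  qed
  ultimately show ?thesis by blast
qed

definition indicators_L2 :: "L2 set" where
  "indicators_L2 = (\<lambda>(q, c). abs_L2 (\<lambda>x. indicator {..<q} x *\<^sub>R c)) ` (\<rat> \<times> {1, \<i>})"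

lemma indicator_measurable_lebOm:
  "A \<in> sets lebesgue \<Longrightarrow> (\<lambda>x. indicator A x *\<^sub>R (c::complex)) \<in> borel_measurable lebOm"
  by (intro measurable_restrict_space1 borel_measurable_scaleR borel_measurable_indicator) auto

lemma square_integrable_indicator:
  assumes "A \<in> sets lebesgue"
  shows "square_integrable (\<lambda>x. indicator A x *\<^sub>R c)"
  by (rule square_integrable_bounded[OF indicator_measurable_lebOm[OF assms], of c "cmod c"])
    (auto simp: indicator_def)

lemma indicator_tendsto_L2:
  assumes A: "\<And>n. A n \<in> sets lebesgue" and B: "B \<in> sets lebesgue"
    and lim: "\<And>x. (\<lambda>n. indicator (A n) x :: real) \<longlonglongrightarrow> indicator B x"
  shows "(\<lambda>n. abs_L2 (\<lambda>x. indicator (A n) x *\<^sub>R c)) \<longlonglongrightarrow> abs_L2 (\<lambda>x. indicator B x *\<^sub>R c)"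
proof (rule abs_L2_tendsto(2)[OF square_integrable_const[of c]
      indicator_measurable_lebOm[OF A] indicator_measurable_lebOm[OF B]])
  show "AE x in lebOm. cmod (indicator (A n) x *\<^sub>R c) \<le> cmod c" for n
    by (rule AE_I2) (simp add: indicator_def)
  show "AE x in lebOm. (\<lambda>n. indicator (A n) x *\<^sub>R c) \<longlonglongrightarrow> indicator B x *\<^sub>R c"
    by (intro AE_I2 tendsto_scaleR lim tendsto_const)
qed

lemma closed_subspace_closure_span: "subspace (closure (span (C :: 'a::real_normed_vector set)))"
  unfolding subspace_def
proof (intro conjI ballI allI)
  show "0 \<in> closure (span C)"
    using closure_subset span_zero by blast
next
  fix x y assume "x \<in> closure (span C)" "y \<in> closure (span C)"
  then obtain f g where "\<And>n::nat. f n \<in> span C" "f \<longlonglongrightarrow> x" "\<And>n::nat. g n \<in> span C" "g \<longlonglongrightarrow> y"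
    unfolding closure_sequential by blast
  then show "x + y \<in> closure (span C)"
    unfolding closure_sequential
    by (intro exI[of _ "\<lambda>n. f n + g n"]) (auto intro: span_add tendsto_add)
next
  fix c :: real and x assume "x \<in> closure (span C)"
  then obtain f where "\<And>n::nat. f n \<in> span C" "f \<longlonglongrightarrow> x"
    unfolding closure_sequential by blast
  then show "c *\<^sub>R x \<in> closure (span C)"
    unfolding closure_sequential
    by (intro exI[of _ "\<lambda>n. c *\<^sub>R f n"]) (auto intro: span_scale tendsto_intros)
qed

lemma indicator_borel_in_closure:
  assumes c: "c \<in> {1, \<i>}" and A: "A \<in> sets borel"
  shows "abs_L2 (\<lambda>x. indicator A x *\<^sub>R c) \<in> closure (span indicators_L2)" (is "?I A \<in> ?V")
proof -
  note sub = closed_subspace_closure_span[of indicators_L2]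
  have seq: "?I B \<in> ?V"
    if "\<And>n. ?I (S n) \<in> ?V" "\<And>n. S n \<in> sets borel" "B \<in> sets borel"
      "\<And>x. (\<lambda>n. indicator (S n) x :: real) \<longlonglongrightarrow> indicator B x" for S B
    by (rule closed_sequentially[OF closed_closure that(1)])
      (rule indicator_tendsto_L2[OF _ _ that(4)], use that in auto)
  have rat: "?I {..<q} \<in> ?V" if "q \<in> \<rat>" for q
  proof -
    have "?I {..<q} \<in> indicators_L2"
      unfolding indicators_L2_def using that c by (intro image_eqI[of _ _ "(q, c)"]) auto
    then show ?thesis
      using span_superset closure_subset by blast
  qed
  have ray: "?I {..<a} \<in> ?V" for a :: real
  proof -
    have "\<exists>q. q \<in> \<rat> \<and> a - 1 / Suc n < q \<and> q < a" for n
      using Rats_dense_in_real[of "a - 1 / Suc n" a] by auto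
    then obtain q where q: "\<And>n. q n \<in> \<rat>" "\<And>n. a - 1 / Suc n < q n" "\<And>n. q n < a"
      by metis
    show ?thesis
    proof (rule seq[of "\<lambda>n. {..<q n}"])
      fix x
      show "(\<lambda>n. indicator {..<q n} x :: real) \<longlonglongrightarrow> indicator {..<a} x"
      proof (cases "x < a")
        case True
        then obtain N where N: "1 / real (Suc N) < a - x"
          using nat_approx_posE[of "a - x"] by auto
        have "x < q n" if "N \<le> n" for n
        proof -
          have "1 / real (Suc n) \<le> 1 / real (Suc N)"
            using that by (intro divide_left_mono) auto
          then show ?thesis using N q(2)[of n] by linarith
        qed
        then have "\<forall>\<^sub>F n in sequentially. indicator {..<q n} x = (indicator {..<a} x :: real)"
          using True by (intro eventually_sequentiallyI[of N]) (auto simp: indicator_def)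
        then show ?thesis by (rule tendsto_eventually)
      next
        case False
        then have "indicator {..<q n} x = (indicator {..<a} x :: real)" for n
          using q(3)[of n] by (auto simp: indicator_def)
        then show ?thesis by simp
      qed
    qed (use rat q in auto)
  qed
  have univ: "?I UNIV \<in> ?V"
  proof -
    have "?I {..<pi} = ?I UNIV"
    proof (subst abs_L2_eq_iff)
      show "AE x in lebOm. indicator {..<pi} x *\<^sub>R c = indicator UNIV x *\<^sub>R c"
        by (rule AE_I2) (simp add: indicator_def)
    qed (rule square_integrable_indicator, simp)+
    then show ?thesis using ray[of pi] by simp
  qed
  have "A \<in> sigma_sets UNIV (range lessThan)"
    using A by (simp add: borel_Iio sets_measure_of)
  then show ?thesis
  proof (induction rule: sigma_sets_induct_disjoint[rotated 2, consumes 1, case_names basic empty compl union int pow])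
    case (basic A)
    then show ?case using ray by auto
  next
    case empty
    have "?I {} = 0"
      by (simp add: zero_L2_def)
    then show ?case
      using subspace_0[OF sub] by simp
  next
    case (compl A)
    then have "A \<in> sets borel"
      by (simp add: borel_Iio sets_measure_of)
    then have "?I UNIV - ?I A = abs_L2 (\<lambda>x. indicator UNIV x *\<^sub>R c - indicator A x *\<^sub>R c)"
      by (intro abs_L2_diff square_integrable_indicator) auto
    also have "(\<lambda>x. indicator UNIV x *\<^sub>R c - indicator A x *\<^sub>R c) = (\<lambda>x. indicator (UNIV - A) x *\<^sub>R c)"
      by (auto simp: indicator_def)
    finally show ?case
      using subspace_diff[OF sub univ compl(2)] by simp
  next
    case (union S)
    have S: "S n \<in> sets borel" for n
      using union(2) by (auto simp: borel_Iio sets_measure_of)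
    have fin: "?I (\<Union>i<n. S i) \<in> ?V" for n :: nat
    proof (induction n)
      case 0
      have "?I {} = 0"
        by (simp add: zero_L2_def)
      then show ?case
        using subspace_0[OF sub] by simp
    next
      case (Suc n)
      have "S i \<inter> S n = {}" if "i < n" for i
        using union(1) that by (simp add: disjoint_family_on_def)
      then have "(\<Union>i<n. S i) \<inter> S n = {}"
        by blast
      then have eq: "(\<lambda>x. indicator (\<Union>i<n. S i) x *\<^sub>R c + indicator (S n) x *\<^sub>R c)
          = (\<lambda>x. indicator (\<Union>i<Suc n. S i) x *\<^sub>R c)"
        by (auto simp: indicator_def less_Suc_eq fun_eq_iff)
      have "?I (\<Union>i<n. S i) + ?I (S n) = ?I (\<Union>i<Suc n. S i)"
        unfolding eq[symmetric]
        by (intro abs_L2_add square_integrable_indicator) (use S in auto)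
      then show ?case
        using subspace_add[OF sub Suc.IH union(3)[of n]] by simp
    qed
    show ?case
    proof (rule seq[of "\<lambda>n. \<Union>i<n. S i"])
      show "(\<lambda>n. indicator (\<Union>i<n. S i) x :: real) \<longlonglongrightarrow> indicator (\<Union>i. S i) x" for x
        by (rule LIMSEQ_indicator_UN)
    qed (use fin S in auto)
  next
    case int
    have "{..<a} \<inter> {..<b} = {..<min a b}" for a b :: real
      by auto
    then show ?case
      unfolding Int_stable_def by (metis (no_types, lifting) imageE rangeI)
  next
    case pow
    show ?case by simp
  qed
qed

lemma indicator_in_closure:
  assumes A: "A \<in> sets lebesgue"
  shows "abs_L2 (\<lambda>x. indicator A x *\<^sub>R c) \<in> closure (span indicators_L2)" (is "_ \<in> ?V")
proof -
  note sub = closed_subspace_closure_span[of indicators_L2]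
  have c1: "abs_L2 (\<lambda>x. indicator A x *\<^sub>R c) \<in> ?V" if c: "c \<in> {1, \<i>}" for c
  proof -
    from A obtain S N N' where "N' \<in> null_sets lborel" "A = S \<union> N" "N \<subseteq> N'" "S \<in> sets lborel"
      by (elim sets_completionE) blast
    then have S: "S \<in> sets borel" and N: "N \<in> null_sets lebesgue" and AS: "A = S \<union> N"
      by (auto intro: null_sets_completion_subset null_sets_completionI)
    have "AE x in lebesgue. x \<notin> N"
      using N by (rule AE_not_in)
    then have AE: "AE x in lebOm. x \<notin> N"
      by (subst AE_restrict_space_iff) (auto elim: eventually_mono)
    have "abs_L2 (\<lambda>x. indicator A x *\<^sub>R c) = abs_L2 (\<lambda>x. indicator S x *\<^sub>R c)"
    proof (subst abs_L2_eq_iff)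
      show "AE x in lebOm. indicator A x *\<^sub>R c = indicator S x *\<^sub>R c"
        using AE by eventually_elim (auto simp: AS indicator_def)
    qed (use S A in \<open>auto intro!: square_integrable_indicator\<close>)
    then show ?thesis
      using indicator_borel_in_closure[OF c S] by simp
  qed
  have "Re c *\<^sub>R abs_L2 (\<lambda>x. indicator A x *\<^sub>R 1) + Im c *\<^sub>R abs_L2 (\<lambda>x. indicator A x *\<^sub>R \<i>) \<in> ?V"
    by (intro subspace_add[OF sub] subspace_scale[OF sub] c1) auto
  also have "Re c *\<^sub>R abs_L2 (\<lambda>x. indicator A x *\<^sub>R 1) + Im c *\<^sub>R abs_L2 (\<lambda>x. indicator A x *\<^sub>R \<i>)
      = abs_L2 (\<lambda>x. Re c *\<^sub>R (indicator A x *\<^sub>R 1)) + abs_L2 (\<lambda>x. Im c *\<^sub>R (indicator A x *\<^sub>R \<i>))"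
    by (intro arg_cong2[where f = plus] abs_L2_scaleR square_integrable_indicator A)
  also have "\<dots> = abs_L2 (\<lambda>x. Re c *\<^sub>R (indicator A x *\<^sub>R 1) + Im c *\<^sub>R (indicator A x *\<^sub>R \<i>))"
    using square_integrable_cmult[OF square_integrable_indicator[OF A]]
    by (intro abs_L2_add) (simp_all only: scaleR_conv_of_real)
  also have "(\<lambda>x. Re c *\<^sub>R (indicator A x *\<^sub>R 1) + Im c *\<^sub>R (indicator A x *\<^sub>R \<i>)) = (\<lambda>x. indicator A x *\<^sub>R c)"
    by (auto simp: indicator_def complex_eq_iff)
  finally show ?thesis .
qed

lemma closure_span_indicators: "closure (span indicators_L2) = UNIV"
proof -
  note sub = closed_subspace_closure_span[of indicators_L2]
  have "h \<in> closure (span indicators_L2)" for h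
  proof -
    have h2: "square_integrable (rep_L2 h)"
      by simp
    then have hm: "rep_L2 h \<in> borel_measurable lebOm"
      by (simp add: square_integrable_def)
    obtain s where s: "\<And>i. simple_function lebOm (s i)"
      and lim: "\<And>x. x \<in> space lebOm \<Longrightarrow> (\<lambda>i. s i x) \<longlonglongrightarrow> rep_L2 h x"
      and bd: "\<And>i x. x \<in> space lebOm \<Longrightarrow> dist (s i x) 0 \<le> 2 * dist (rep_L2 h x) 0"
      using borel_measurable_implies_sequence_metric[OF hm, of 0] by metis
    have sm: "s i \<in> borel_measurable lebOm" for i
      by (rule borel_measurable_simple_function[OF s])
    have mem: "abs_L2 (s i) \<in> closure (span indicators_L2)" for i
    proof -
      let ?Y = "s i ` Om" and ?A = "\<lambda>y. s i -` {y} \<inter> Om"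
      have fin: "finite ?Y"
        using s[of i] by (simp add: simple_function_def)
      have A: "?A y \<in> sets lebesgue" if "y \<in> ?Y" for y
      proof -
        have "?A y \<in> sets lebOm"
          using s[of i] that by (auto simp: simple_function_def)
        then show ?thesis by (simp add: sets_restrict_space_iff)
      qed
      have part: "square_integrable (\<lambda>x. \<Sum>y\<in>F. indicator (?A y) x *\<^sub>R y) \<and>
          abs_L2 (\<lambda>x. \<Sum>y\<in>F. indicator (?A y) x *\<^sub>R y) \<in> closure (span indicators_L2)"
        if "finite F" "F \<subseteq> ?Y" for F
        using that
      proof (induction F)
        case empty
        then show ?case
          using square_integrable_const[of 0] subspace_0[OF sub] by (simp add: zero_L2_def)
      next
        case (insert y F)
        have IH: "square_integrable (\<lambda>x. \<Sum>y\<in>F. indicator (?A y) x *\<^sub>R y)"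
          "abs_L2 (\<lambda>x. \<Sum>y\<in>F. indicator (?A y) x *\<^sub>R y) \<in> closure (span indicators_L2)"
          using insert.IH insert.prems by (simp_all only: insert_subset simp_thms)
        have y: "?A y \<in> sets lebesgue"
          using insert.prems by (intro A) auto
        note y2 = square_integrable_indicator[OF y, of y]
        show ?case
          using square_integrable_add[OF y2 IH(1)] abs_L2_add[OF y2 IH(1)]
            subspace_add[OF sub indicator_in_closure[OF y, of y] IH(2)]
          by (simp only: sum.insert[OF insert.hyps] simp_thms)
      qed
      have eq: "s i x = (\<Sum>y\<in>?Y. indicator (?A y) x *\<^sub>R y)" if "x \<in> Om" for x
      proof -
        have "(\<Sum>y\<in>?Y. indicator (?A y) x *\<^sub>R y) = (\<Sum>y\<in>?Y. if y = s i x then y else 0)"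
          using that by (intro sum.cong) (auto simp: indicator_def)
        then show ?thesis
          using fin that by (simp add: sum.delta)
      qed
      have s2: "square_integrable (s i)"
      proof (rule square_integrable_bound[OF square_integrable_cmult[OF h2, of 2] sm])
        show "AE x in lebOm. cmod (s i x) \<le> cmod (2 * rep_L2 h x)"
          using bd[of _ i] by (intro AE_I2) (simp add: norm_mult)
      qed
      have "abs_L2 (s i) = abs_L2 (\<lambda>x. \<Sum>y\<in>?Y. indicator (?A y) x *\<^sub>R y)"
        unfolding abs_L2_eq_iff[OF s2 conjunct1[OF part[OF fin order_refl]]]
        by (rule AE_I2, rule eq) simp
      then show ?thesis
        using conjunct2[OF part[OF fin order_refl]] by (simp only:)
    qed
    have "(\<lambda>i. abs_L2 (s i)) \<longlonglongrightarrow> abs_L2 (rep_L2 h)"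
    proof (rule abs_L2_tendsto(2)[OF square_integrable_cmult[OF h2, of 2] sm hm])
      show "AE x in lebOm. cmod (s i x) \<le> cmod (2 * rep_L2 h x)" for i
        using bd[of _ i] by (intro AE_I2) (simp add: norm_mult)
      show "AE x in lebOm. (\<lambda>i. s i x) \<longlonglongrightarrow> rep_L2 h x"
        using lim by (intro AE_I2) 
    qed
    then show ?thesis
      using closed_sequentially[OF closed_closure mem] by simp
  qed
  then show ?thesis by blast
qed

instance L2 :: second_countable_topology
proof
  have "countable indicators_L2"
    unfolding indicators_L2_def by (intro countable_image countable_SIGMA) (auto simp: countable_rat)
  then obtain D where D: "countable D" "span indicators_L2 \<subseteq> closure D"
    using countable_dense_in_span by blast
  have "closure D = UNIV"
    using closure_mono[OF D(2)] closure_span_indicators by auto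
  then have "\<exists>d\<in>D. dist x d < e" if "0 < e" for x e
    using that closure_approachable[of x D] by (auto simp: dist_commute)
  then show "\<exists>B::L2 set set. countable B \<and> open = generate_topology B"
    by (rule second_countable_from_dense[OF D(1)])
qed

lift_definition scaleC_L2 :: "complex \<Rightarrow> L2 \<Rightarrow> L2" is "\<lambda>c f x. c * f x"
  by (auto intro!: square_integrable_cmult)

(* Intended for measurable A only, otherwise the product need not be square-integrable. *)
definition cutoff :: "real set \<Rightarrow> L2 \<Rightarrow> L2" where
  "cutoff A f = abs_L2 (\<lambda>x. indicator A x *\<^sub>R rep_L2 f x)"

(* L^2(A), identified with the subspace of its extensions by zero. *)
definition L2_on :: "real set \<Rightarrow> L2 set" where
  "L2_on A = {f. AE x in lebOm. x \<notin> A \<longrightarrow> rep_L2 f x = 0}"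


section \<open>Sobolev spaces on the interval\<close>

(* C^1 functions with compact support in the open interval. Smooth test functions give the
   same weak derivatives, and the same closure in H^1. *)
definition test_function :: "(real \<Rightarrow> complex) \<Rightarrow> bool" where
  "test_function \<phi> \<longleftrightarrow> \<phi> C1_differentiable_on UNIV \<and>
     (\<exists>K. compact K \<and> K \<subseteq> Om \<and> (\<forall>x. x \<notin> K \<longrightarrow> \<phi> x = 0))"

definition has_weak_derivative :: "L2 \<Rightarrow> L2 \<Rightarrow> bool" where
  "has_weak_derivative f g \<longleftrightarrow>
     (\<forall>\<phi>. test_function \<phi> \<longrightarrow>
        (LINT x|lebOm. rep_L2 f x * vector_derivative \<phi> (at x)) =
        - (LINT x|lebOm. rep_L2 g x * \<phi> x))"

definition H1 :: "L2 set" where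
  "H1 = {f. \<exists>g. has_weak_derivative f g}"

(* Closure of the test functions for the H^1 norm. *)
definition H1_0 :: "L2 set" where
  "H1_0 = {f. \<exists>g \<phi>. has_weak_derivative f g \<and> (\<forall>n::nat. test_function (\<phi> n)) \<and>
     (\<lambda>n. abs_L2 (\<phi> n)) \<longlonglongrightarrow> f \<and>
     (\<lambda>n. abs_L2 (\<lambda>x. vector_derivative (\<phi> n) (at x))) \<longlonglongrightarrow> g}"


section \<open>Strongly continuous semigroups and mild solutions\<close>

type_synonym state = "L2 \<times> L2 \<times> L2"

fun scaleC_state :: "complex \<Rightarrow> state \<Rightarrow> state" where
  "scaleC_state c (\<rho>, u, S) = (scaleC_L2 c \<rho>, scaleC_L2 c u, scaleC_L2 c S)"

definition C0_semigroup :: "(real \<Rightarrow> state \<Rightarrow> state) \<Rightarrow> bool" where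
  "C0_semigroup U \<longleftrightarrow>
     (\<forall>t\<ge>0. bounded_linear (U t) \<and> (\<forall>c z. U t (scaleC_state c z) = scaleC_state c (U t z))) \<and>
     U 0 = id \<and>
     (\<forall>s\<ge>0. \<forall>t\<ge>0. U (s + t) = U s \<circ> U t) \<and>
     (\<forall>z. ((\<lambda>t. U t z) \<longlongrightarrow> z) (at_right 0))"

(* Unbounded operators are represented by their graphs, so that the domain is part of the data. *)
definition generator :: "(real \<Rightarrow> state \<Rightarrow> state) \<Rightarrow> (state \<times> state) set" where
  "generator U = {(z, w). ((\<lambda>h. (U h z - z) /\<^sub>R h) \<longlongrightarrow> w) (at_right 0)}"

(* A C_0-semigroup is determined on [0,oo) by its generator, so at most one z satisfies this. *)
definition mild_solution ::
  "(state \<times> state) set \<Rightarrow> real \<Rightarrow> state \<Rightarrow> (real \<Rightarrow> state) \<Rightarrow> (real \<Rightarrow> state) \<Rightarrow> bool" where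
  "mild_solution A T z0 F z \<longleftrightarrow>
     continuous_on {0..T} z \<and>
     (\<exists>U. C0_semigroup U \<and> generator U = A \<and>
        (\<forall>t\<in>{0..T}. z t = U t z0 + (LINT s|lebesgue_on {0<..<t}. U (t - s) (F s))))"


section \<open>The control system\<close>

definition system_op :: "real \<Rightarrow> real \<Rightarrow> real \<Rightarrow> real \<Rightarrow> real \<Rightarrow> (state \<times> state) set" where
  "system_op a \<gamma> \<rho>s \<mu> \<kappa> =
     (let b = a * \<gamma> * \<rho>s powr (\<gamma> - 2) in
      {((\<rho>, u, S), (- \<rho>s *\<^sub>R u', \<sigma>', (\<mu> / \<kappa>) *\<^sub>R u' - (1 / \<kappa>) *\<^sub>R S)) | \<rho> u S u' \<sigma>'.
         u \<in> H1_0 \<and> has_weak_derivative u u' \<and>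
         - b *\<^sub>R \<rho> + (1 / \<rho>s) *\<^sub>R S \<in> H1 \<and>
         has_weak_derivative (- b *\<^sub>R \<rho> + (1 / \<rho>s) *\<^sub>R S) \<sigma>'})"

(* L^2(0,T; L^2(A)), with Bochner measurability (L2 is separable). *)
definition L2_controls :: "real \<Rightarrow> real set \<Rightarrow> (real \<Rightarrow> L2) set" where
  "L2_controls T A = {f. f \<in> borel_measurable (lebesgue_on {0<..<T}) \<and>
     integrable (lebesgue_on {0<..<T}) (\<lambda>t. (norm (f t))\<^sup>2) \<and>
     (AE t in lebesgue_on {0<..<T}. f t \<in> L2_on A)}"

definition null_controllable ::
  "real \<Rightarrow> real \<Rightarrow> real \<Rightarrow> real \<Rightarrow> real \<Rightarrow> real set \<Rightarrow> real set \<Rightarrow> real set \<Rightarrow> real \<Rightarrow> bool" where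
  "null_controllable a \<gamma> \<rho>s \<mu> \<kappa> O1 O2 O3 T \<longleftrightarrow>
     (\<forall>\<rho>0 u0 S0. \<exists>f1\<in>L2_controls T O1. \<exists>f2\<in>L2_controls T O2. \<exists>f3\<in>L2_controls T O3. \<exists>z.
        mild_solution (system_op a \<gamma> \<rho>s \<mu> \<kappa>) T (\<rho>0, u0, S0)
          (\<lambda>t. (cutoff O1 (f1 t), cutoff O2 (f2 t), cutoff O3 (f3 t))) z \<and>
        z T = (0, 0, 0))"

end

theory Submission
  imports Defs
begin

text \<open>
  The combination \<open>- b \<rho> + S / \<rho>s\<close> is coupled to \<open>u\<close> hyperbolically, but the system has a further,
  non-propagating mode of fixed decay rate \<open>\<alpha>\<close> along which singularities stay in place. For a
  test function \<open>G\<close> supported in \<open>W = (0, pi) - closure (O1 \<union> O3)\<close> put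
  \<open>\<Psi> = ((\<mu> / \<kappa>) G', c G, \<rho>s G')\<close>. With suitable \<open>\<alpha>\<close> and \<open>c\<close> this satisfies
  \<open>A\<^sup>* \<Psi> = - \<alpha> \<Psi> + (0, \<alpha> c G, 0)\<close>, where the error involves \<open>G\<close> but not \<open>G'\<close>. The controls
  \<open>f1\<close> and \<open>f3\<close> do not see \<open>\<Psi>\<close>, and \<open>f2\<close> sees it only through \<open>c G\<close>. Hence a state \<open>z0\<close> that is
  steered to zero satisfies \<open>\<bar>z0 \<bullet> \<Psi>\<bar> \<le> C norm G\<close> with \<open>C\<close> independent of \<open>G\<close>, i.e.
  \<open>(\<mu> / \<kappa>) \<rho>0 + \<rho>s S0\<close> is weakly differentiable on \<open>W\<close>. If \<open>u0 = S0 = 0\<close> and \<open>\<rho>0\<close> jumps at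
  \<open>x0 \<in> W\<close>, the left-hand side is \<open>(\<mu> / \<kappa>) \<bar>G x0\<bar>\<close>, and narrow bumps \<open>G\<close> give a contradiction.
\<close>

section \<open>Strongly continuous semigroups\<close>

text \<open>Baire category: the closed sets \<open>V n\<close>, on which all \<open>f i\<close> are
  bounded by \<open>n\<close>, cover the space, so one of them contains a ball. By linearity a
  common bound on a ball becomes a common bound on the operator norms.\<close>

theorem uniform_boundedness_principle:
  fixes f :: "'i \<Rightarrow> 'a::banach \<Rightarrow> 'b::real_normed_vector"
  assumes lin: "\<And>i. i \<in> I \<Longrightarrow> bounded_linear (f i)"
    and bd: "\<And>x. \<exists>B. \<forall>i\<in>I. norm (f i x) \<le> B"
  shows "\<exists>K. \<forall>i\<in>I. \<forall>x. norm (f i x) \<le> K * norm x"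
proof -
  define V where "V n = (\<Inter>i\<in>I. {x. norm (f i x) \<le> real n})" for n
  have closed_V: "closed (V n)" for n
    unfolding V_def
    by (intro closed_INT ballI closed_Collect_le continuous_intros)
      (use lin in \<open>auto intro: linear_continuous_on\<close>)
  have cover: "(\<Union>n. V n) = UNIV"
  proof -
    have "\<exists>n. x \<in> V n" for x
    proof -
      obtain B where B: "\<forall>i\<in>I. norm (f i x) \<le> B" using bd by blast
      obtain n where "B \<le> real n" using real_arch_simple by blast
      then show ?thesis using B by (auto simp: V_def intro!: exI[of _ n])
    qed
    then show ?thesis by blast
  qed
  have "\<exists>n. interior (V n) \<noteq> {}"
  proof (rule ccontr)
    assume "\<nexists>n. interior (V n) \<noteq> {}"
    then have "(euclidean :: 'a topology) interior_of \<Union>(range V) = {}"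
      by (intro Baire_category_alt disjI1 completely_metrizable_space_euclidean)
        (use closed_V in auto)
    then show False using cover by simp
  qed
  then obtain n c where "c \<in> interior (V n)" by blast
  then obtain r where r: "0 < r" "cball c r \<subseteq> V n"
    unfolding mem_interior_cball by blast
  have "norm (f i x) \<le> (2 * real n / r) * norm x" if i: "i \<in> I" for i x
  proof (cases "x = 0")
    case True
    then show ?thesis using linear_0[OF bounded_linear.linear[OF lin[OF i]]] by simp
  next
    case False
    interpret f: bounded_linear "f i" using lin[OF i] .
    \<comment> \<open>\<open>x\<close> is rescaled to norm \<open>r\<close>, so that
      \<open>c\<close> and \<open>c + y\<close> both lie in the ball; subtracting the value at the
      centre costs the factor 2.\<close>
    define y where "y = (r / norm x) *\<^sub>R x"
    have "norm y = r" using False r by (simp add: y_def)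
    then have "c + y \<in> V n" "c \<in> V n" using r by (auto intro!: subsetD[OF r(2)] simp: dist_norm)
    then have "norm (f i (c + y)) \<le> n" "norm (f i c) \<le> n" using i by (auto simp: V_def)
    then have "norm (f i (c + y) - f i c) \<le> 2 * real n"
      using norm_triangle_ineq4[of "f i (c + y)" "f i c"] by linarith
    then have "norm (f i y) \<le> 2 * real n" by (simp add: f.add)
    then have "r / norm x * norm (f i x) \<le> 2 * real n"
      using r by (simp add: y_def f.scaleR)
    then show ?thesis using False r by (simp add: field_simps)
  qed
  then show ?thesis by blast
qed

section \<open>Local boundedness and continuity of orbits\<close>

lemma C0_semigroup_linear: "C0_semigroup U \<Longrightarrow> 0 \<le> t \<Longrightarrow> bounded_linear (U t)"
  and C0_semigroup_0: "C0_semigroup U \<Longrightarrow> U 0 y = y"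
  and C0_semigroup_add: "C0_semigroup U \<Longrightarrow> 0 \<le> s \<Longrightarrow> 0 \<le> t \<Longrightarrow> U (s + t) y = U s (U t y)"
  and C0_semigroup_tendsto: "C0_semigroup U \<Longrightarrow> ((\<lambda>t. U t y) \<longlongrightarrow> y) (at_right 0)"
  by (simp_all add: C0_semigroup_def del: split_paired_All)

text \<open>Otherwise there are times \<open>t n\<close> tending to 0 at which the operator norm
  exceeds \<open>Suc n\<close>, although strong continuity at 0 keeps each orbit bounded along these
  times; this contradicts uniform boundedness.\<close>

lemma C0_semigroup_bounded_near_0:
  assumes U: "C0_semigroup U"
  shows "\<exists>d>0. \<exists>M\<ge>1. \<forall>t\<in>{0..d}. \<forall>y. norm (U t y) \<le> M * norm y"
proof (rule ccontr)
  assume neg: "\<not> ?thesis"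
  have "\<exists>t y. 0 \<le> t \<and> t \<le> 1 / Suc n \<and> norm (U t y) > Suc n * norm y" for n
  proof (rule ccontr)
    assume "\<nexists>t y. 0 \<le> t \<and> t \<le> 1 / Suc n \<and> norm (U t y) > Suc n * norm y"
    then have "\<forall>t\<in>{0..1 / Suc n}. \<forall>y. norm (U t y) \<le> real (Suc n) * norm y"
      by (auto simp: not_less)
    moreover have "0 < 1 / real (Suc n)" "1 \<le> real (Suc n)" by auto
    ultimately show False using neg by blast
  qed
  then obtain t y where t: "\<And>n. 0 \<le> t n" "\<And>n. t n \<le> 1 / Suc n"
    and big: "\<And>n. norm (U (t n) (y n)) > Suc n * norm (y n)"
    by metis
  have t0: "t \<longlonglongrightarrow> 0"
    by (rule tendsto_sandwich[OF _ _ tendsto_const LIMSEQ_inverse_real_of_nat])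
      (use t in \<open>auto simp: inverse_eq_divide\<close>)
  have "\<exists>B. \<forall>n\<in>UNIV. norm (U (t n) x) \<le> B" for x
  proof -
    \<comment> \<open>Some \<open>t n\<close> may be 0, a point that \<open>at_right 0\<close>
      leaves out. As \<open>U 0\<close> is the identity, the limit is continuity at 0 within
      \<open>{0..}\<close>.\<close>
    have "((\<lambda>t. U t x) \<longlongrightarrow> x) (at 0 within {0..})"
    proof -
      have "((\<lambda>t. U t x) \<longlongrightarrow> x) (at 0 within {0<..})"
        using C0_semigroup_tendsto[OF U] .
      moreover have "at (0::real) within {0..} = at 0 within {0<..}"
        by (rule at_within_nhd[of _ UNIV]) auto
      ultimately show ?thesis by simp
    qed
    then have "continuous (at 0 within {0..}) (\<lambda>t. U t x)"
      by (simp add: continuous_within C0_semigroup_0[OF U])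
    then have "(\<lambda>n. U (t n) x) \<longlonglongrightarrow> U 0 x"
      using t0 t(1) unfolding continuous_within_sequentially by (auto simp: o_def)
    then have "Bseq (\<lambda>n. U (t n) x)" by (intro convergent_imp_Bseq convergentI)
    then show ?thesis unfolding Bseq_def by blast
  qed
  then obtain K where K: "\<And>n x. norm (U (t n) x) \<le> K * norm x"
    using uniform_boundedness_principle[of UNIV "\<lambda>n. U (t n)"] C0_semigroup_linear[OF U t(1)]
    by blast
  obtain n where n: "K \<le> real n" using real_arch_simple by blast
  have "Suc n * norm (y n) \<le> K * norm (y n)" using K[of n "y n"] big[of n] by linarith
  moreover have "K * norm (y n) \<le> Suc n * norm (y n)"
    using n by (intro mult_right_mono) auto
  ultimately show False using K[of n "y n"] big[of n] by linarith
qed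

text \<open>A time up to \<open>n * d\<close> splits into at most \<open>n\<close> steps of length
  at most \<open>d\<close>, each costing a factor \<open>M\<close>; since 1 \<le> M, the bound
  \<open>M ^ n\<close> also covers shorter times.\<close>

lemma C0_semigroup_locally_bounded:
  assumes U: "C0_semigroup U"
  shows "\<exists>M\<ge>0. \<forall>t\<in>{0..T}. \<forall>y. norm (U t y) \<le> M * norm y"
proof -
  obtain d M where d: "0 < d" and M: "1 \<le> M"
    and bd: "\<And>t y. t \<in> {0..d} \<Longrightarrow> norm (U t y) \<le> M * norm y"
    using C0_semigroup_bounded_near_0[OF U] by blast
  have step: "\<forall>t\<in>{0..real n * d}. \<forall>y. norm (U t y) \<le> M ^ n * norm y" for n
  proof (induction n)
    case 0
    then show ?case by (simp add: C0_semigroup_0[OF U])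
  next
    case (Suc n)
    show ?case
    proof (intro ballI allI)
      fix t y assume t: "t \<in> {0..real (Suc n) * d}"
      show "norm (U t y) \<le> M ^ Suc n * norm y"
      proof (cases "t \<le> d")
        case True
        have "norm (U t y) \<le> M * norm y" using bd True t by simp
        also have "\<dots> \<le> M ^ Suc n * norm y"
          using M by (intro mult_right_mono self_le_power) auto
        finally show ?thesis .
      next
        case False
        have "U t y = U d (U (t - d) y)"
          using C0_semigroup_add[OF U, of d "t - d" y] False d by simp
        also have "norm \<dots> \<le> M * norm (U (t - d) y)" using bd d by simp
        also have "\<dots> \<le> M * (M ^ n * norm y)"
          using Suc.IH[rule_format, of "t - d" y] t False M
          by (intro mult_left_mono) (auto simp: algebra_simps)
        finally show ?thesis by (simp add: mult.assoc)
      qed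
    qed
  qed
  obtain n where "T / d \<le> real n" using real_arch_simple by blast
  then have "T \<le> real n * d" using d by (simp add: field_simps)
  then show ?thesis using step[of n] M by (intro exI[of _ "M ^ n"]) auto
qed

text \<open>Continuity is assumed only from the right at 0. Factoring out the operator at the
  smaller of two times, whose norm is locally bounded, transfers it to both sides of every
  time.\<close>

lemma C0_semigroup_continuous:
  assumes U: "C0_semigroup U"
  shows "continuous_on {0..T} (\<lambda>t. U t y)"
proof -
  obtain M where M: "0 \<le> M" and bd: "\<And>t y. t \<in> {0..T} \<Longrightarrow> norm (U t y) \<le> M * norm y"
    using C0_semigroup_locally_bounded[OF U] by blast
  have est: "norm (U t y - U s y) \<le> M * norm (U \<bar>t - s\<bar> y - y)" if "s \<in> {0..T}" "t \<in> {0..T}" for s t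
  proof -
    have *: "norm (U t y - U s y) \<le> M * norm (U (t - s) y - y)" if "s \<in> {0..T}" "s \<le> t" for s t
    proof -
      interpret Us: bounded_linear "U s" using C0_semigroup_linear[OF U] that by simp
      have "U t y = U s (U (t - s) y)" using C0_semigroup_add[OF U, of s "t - s" y] that by simp
      then have "U t y - U s y = U s (U (t - s) y - y)" by (simp add: Us.diff)
      then show ?thesis using bd[OF that(1)] by simp
    qed
    show ?thesis
      using *[of s t] *[of t s] that by (cases "s \<le> t") (auto simp: norm_minus_commute)
  qed
  show ?thesis
    unfolding continuous_on_iff
  proof (intro ballI allI impI)
    fix s e :: real assume s: "s \<in> {0..T}" and e: "0 < e"
    have "\<forall>\<^sub>F h in at_right 0. dist (U h y) y < e / (M + 1)"
      using e M by (intro tendstoD[OF C0_semigroup_tendsto[OF U]]) simp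
    then obtain d where d: "0 < d" "\<And>h. 0 < h \<Longrightarrow> h < d \<Longrightarrow> dist (U h y) y < e / (M + 1)"
      unfolding eventually_at_right_field by auto
    have "dist (U t y) (U s y) < e" if t: "t \<in> {0..T}" "dist t s < d" for t
    proof (cases "t = s")
      case False
      have "norm (U \<bar>t - s\<bar> y - y) \<le> e / (M + 1)"
        using d(2)[of "\<bar>t - s\<bar>"] False t by (simp add: dist_norm)
      then have "M * norm (U \<bar>t - s\<bar> y - y) \<le> M * (e / (M + 1))"
        using M by (intro mult_left_mono)
      also have "\<dots> < e" using M e by (simp add: field_simps)
      finally show ?thesis using est[OF s t(1)] by (simp add: dist_norm)
    qed (use e in simp)
    then show "\<exists>d>0. \<forall>x'\<in>{0..T}. dist x' s < d \<longrightarrow> dist (U x' y) (U s y) < e"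
      using d by blast
  qed
qed

section \<open>Orbits tested against the domain of the adjoint\<close>

lemma has_vector_derivative_right_quotient:
  assumes "(f has_vector_derivative D) (at_right r)"
  shows "((\<lambda>h. (f (r + h) - f r) /\<^sub>R h) \<longlongrightarrow> D) (at_right 0)"
proof -
  have "((\<lambda>x. (1 / norm (x - r)) *\<^sub>R (f x - (f r + (x - r) *\<^sub>R D))) \<longlongrightarrow> 0) (at_right r)"
    using assms unfolding has_vector_derivative_def has_derivative_within by blast
  moreover have "\<forall>\<^sub>F x in at_right r. (1 / norm (x - r)) *\<^sub>R (f x - (f r + (x - r) *\<^sub>R D))
      = (f x - f r) /\<^sub>R (x - r) - D"
    unfolding eventually_at_right_field
    by (intro exI[of _ "r + 1"]) (auto simp: scaleR_diff_right scaleR_add_right inverse_eq_divide)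
  ultimately have "((\<lambda>x. (f x - f r) /\<^sub>R (x - r)) \<longlongrightarrow> D) (at_right r)"
    by (rule LIM_zero_cancel[OF Lim_transform_eventually])
  then show ?thesis
    by (subst (asm) filterlim_at_right_to_0) (simp add: add.commute)
qed

text \<open>The orbit of an arbitrary \<open>y\<close> need not meet the domain of the generator,
  but its time integrals lie in it. With \<open>I r\<close> the integral up to \<open>r\<close>, the
  increment \<open>U h (I t) - I t\<close> is \<open>(I (t + h) - I t) - I h\<close>, and both
  difference quotients converge because the orbit is continuous.\<close>

lemma generator_integral:
  assumes U: "C0_semigroup U" and t: "0 \<le> t"
  shows "(integral {0..t} (\<lambda>s. U s y), U t y - y) \<in> generator U"
proof -
  define I where "I r = integral {0..r} (\<lambda>s. U s y)" for r
  have int: "(\<lambda>s. U s y) integrable_on {a..b}" if "0 \<le> a" for a b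
  proof (rule integrable_continuous_real)
    show "continuous_on {a..b} (\<lambda>s. U s y)"
      using C0_semigroup_continuous[OF U] by (rule continuous_on_subset) (use that in auto)
  qed
  have I0: "I 0 = 0" by (simp add: I_def)
  have shift: "U h (I t) = I (t + h) - I h" if h: "0 < h" for h
  proof -
    have "U h (I t) = integral {0..t} (U h \<circ> (\<lambda>s. U s y))"
      unfolding I_def using C0_semigroup_linear[OF U] h int by (intro integral_linear[symmetric]) auto
    also have "\<dots> = integral {0..t} ((\<lambda>s. U s y) \<circ> (+) h)"
      using h by (intro integral_cong) (simp add: C0_semigroup_add[OF U])
    also have "\<dots> = integral {h..t + h} (\<lambda>s. U s y)"
      by (simp add: integral_shift_Icc_real)
    also have "\<dots> = I (t + h) - I h"
      using Henstock_Kurzweil_Integration.integral_combine[of 0 h "t + h" "\<lambda>s. U s y"] int[of 0] h t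
      by (simp add: I_def algebra_simps)
    finally show ?thesis .
  qed
  have deriv: "((\<lambda>h. (I (r + h) - I r) /\<^sub>R h) \<longlongrightarrow> U r y) (at_right 0)" if r: "0 \<le> r" for r
  proof -
    have "(I has_vector_derivative U r y) (at r within {0..r + 1})"
      unfolding I_def
      by (rule integral_has_vector_derivative[OF C0_semigroup_continuous[OF U]]) (use r in auto)
    then have "(I has_vector_derivative U r y) (at r within {r..r + 1})"
      by (rule has_vector_derivative_within_subset) (use r in auto)
    then show ?thesis
      by (intro has_vector_derivative_right_quotient) (simp add: at_within_Icc_at_right)
  qed
  have "((\<lambda>h. (I (t + h) - I t) /\<^sub>R h - (I (0 + h) - I 0) /\<^sub>R h) \<longlongrightarrow> U t y - U 0 y) (at_right 0)"
    by (intro tendsto_diff deriv t order_refl)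
  moreover have "\<forall>\<^sub>F h in at_right 0. (I (t + h) - I t) /\<^sub>R h - (I (0 + h) - I 0) /\<^sub>R h
      = (U h (I t) - I t) /\<^sub>R h"
    unfolding eventually_at_right_field
    by (intro exI[of _ 1]) (auto simp: shift scaleR_diff_right I0)
  ultimately have "((\<lambda>h. (U h (I t) - I t) /\<^sub>R h) \<longlongrightarrow> U t y - U 0 y) (at_right 0)"
    by (rule Lim_transform_eventually)
  then show ?thesis by (simp add: generator_def I_def C0_semigroup_0[OF U])
qed

text \<open>The hypothesis \<open>adj\<close> puts \<Psi> in the domain of the adjoint of the
  generator, with image \<Theta>. Pairing \<open>generator_integral\<close> with \<Psi> gives an
  integral formula for every \<open>y\<close>, also outside the domain of the generator.\<close>

lemma C0_semigroup_inner_derivative: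
  assumes U: "C0_semigroup U"
    and adj: "\<And>z w. (z, w) \<in> generator U \<Longrightarrow> w \<bullet> \<Psi> = z \<bullet> \<Theta>"
    and t: "t \<in> {0..T}"
  shows "((\<lambda>t. U t y \<bullet> \<Psi>) has_real_derivative U t y \<bullet> \<Theta>) (at t within {0..T})"
proof -
  note cont = C0_semigroup_continuous[OF U, of T y]
  have eq: "U s y \<bullet> \<Psi> = y \<bullet> \<Psi> + integral {0..s} (\<lambda>r. U r y) \<bullet> \<Theta>" if "s \<in> {0..T}" for s
    using adj[OF generator_integral[OF U, of s y]] that by (simp add: inner_diff_left)
  have "((\<lambda>s. integral {0..s} (\<lambda>r. U r y)) has_vector_derivative U t y) (at t within {0..T})"
    by (rule integral_has_vector_derivative[OF cont t])
  then have "((\<lambda>s. integral {0..s} (\<lambda>r. U r y) \<bullet> \<Theta>) has_vector_derivative U t y \<bullet> \<Theta>) (at t within {0..T})"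
    by (rule bounded_linear.has_vector_derivative[OF bounded_linear_inner_left])
  then have "((\<lambda>s. y \<bullet> \<Psi> + integral {0..s} (\<lambda>r. U r y) \<bullet> \<Theta>) has_vector_derivative 0 + U t y \<bullet> \<Theta>)
      (at t within {0..T})"
    by (intro has_vector_derivative_add has_vector_derivative_const)
  then have "((\<lambda>s. U s y \<bullet> \<Psi>) has_vector_derivative U t y \<bullet> \<Theta>) (at t within {0..T})"
    using has_vector_derivative_transform[OF t eq] by simp
  then show ?thesis by (simp add: has_real_derivative_iff_has_vector_derivative)
qed

text \<open>The factor \<open>exp (\<alpha> * t)\<close> cancels the eigenvalue, so the weighted
  pairing has derivative \<open>exp (\<alpha> * t) * (U t y \<bullet> Q)\<close>. Its drift is thus
  controlled by \<open>norm Q\<close>, however large \<open>norm \<Psi>\<close> is.\<close>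

lemma C0_semigroup_approx_eigenvector:
  assumes U: "C0_semigroup U"
    and adj: "\<And>z w. (z, w) \<in> generator U \<Longrightarrow> w \<bullet> \<Psi> = z \<bullet> (- \<alpha> *\<^sub>R \<Psi> + Q)"
    and bd: "\<And>t y. t \<in> {0..T} \<Longrightarrow> norm (U t y) \<le> M * norm y"
    and \<alpha>: "0 \<le> \<alpha>" and t: "t \<in> {0..T}"
  shows "\<bar>exp (\<alpha> * t) * (U t y \<bullet> \<Psi>) - y \<bullet> \<Psi>\<bar> \<le> T * exp (\<alpha> * T) * M * norm y * norm Q"
proof -
  let ?p = "\<lambda>t. exp (\<alpha> * t) * (U t y \<bullet> \<Psi>)"
  let ?B = "exp (\<alpha> * T) * (M * norm y * norm Q)"
  have "norm (?p t - ?p 0) \<le> ?B * norm (t - 0)"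
  proof (rule field_differentiable_bound[of "{0..T}" ?p "\<lambda>s. exp (\<alpha> * s) * (U s y \<bullet> Q)"])
    fix s assume s: "s \<in> {0..T}"
    show "(?p has_field_derivative exp (\<alpha> * s) * (U s y \<bullet> Q)) (at s within {0..T})"
    proof -
      have "U s y \<bullet> (- \<alpha> *\<^sub>R \<Psi> + Q) = - \<alpha> * (U s y \<bullet> \<Psi>) + U s y \<bullet> Q"
        by (simp only: inner_add_right inner_scaleR_right)
      then show ?thesis
        by - ((rule derivative_eq_intros C0_semigroup_inner_derivative[OF U adj s] refl | assumption)+,
          simp add: algebra_simps)
    qed
    have "\<bar>U s y \<bullet> Q\<bar> \<le> M * norm y * norm Q"
      using Cauchy_Schwarz_ineq2[of "U s y" Q] mult_right_mono[OF bd[OF s, of y], of "norm Q"] by simp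
    moreover have "exp (\<alpha> * s) \<le> exp (\<alpha> * T)"
      using s \<alpha> by (simp add: mult_left_mono)
    ultimately show "norm (exp (\<alpha> * s) * (U s y \<bullet> Q)) \<le> ?B"
      unfolding norm_mult by (intro mult_mono) auto
  qed (use t in auto)
  also have "\<dots> \<le> ?B * T"
  proof (rule mult_left_mono)
    have "0 \<le> M * norm y" using bd[OF t, of y] norm_ge_zero order_trans by blast
    then show "0 \<le> ?B" by simp
  qed (use t in auto)
  finally show ?thesis by (simp add: C0_semigroup_0[OF U] mult_ac)
qed

text \<open>Duality: Duhamel's formula with \<open>z T = 0\<close> expresses \<open>U T z0\<close>
  through the forcing, and the approximate eigenvector estimate applies to \<open>z0\<close> and to
  each \<open>F s\<close>. The number \<open>q\<close> measures how strongly the forcing sees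
  \<Psi>; \<open>K\<close> is fixed before \<Psi>, \<open>Q\<close> and \<open>q\<close>.\<close>

lemma null_solution_bound:
  assumes mild: "mild_solution A T z0 F z" and zT: "z T = 0" and T: "0 < T" and \<alpha>: "0 \<le> \<alpha>"
    and n: "integrable (lebesgue_on {0<..<T}) n" and Fn: "\<And>s. norm (F s) \<le> n s"
  shows "\<exists>K\<ge>0. \<forall>\<Psi> Q q. (\<forall>(z, w)\<in>A. w \<bullet> \<Psi> = z \<bullet> (- \<alpha> *\<^sub>R \<Psi> + Q)) \<longrightarrow>
    (\<forall>s. \<bar>F s \<bullet> \<Psi>\<bar> \<le> n s * q) \<longrightarrow> 0 \<le> q \<longrightarrow> \<bar>z0 \<bullet> \<Psi>\<bar> \<le> K * (norm Q + q)"
proof -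
  obtain U where U: "C0_semigroup U" and gen: "generator U = A"
    and duhamel: "z T = U T z0 + (LINT s|lebesgue_on {0<..<T}. U (T - s) (F s))"
    using mild T unfolding mild_solution_def by auto
  obtain M where M: "0 \<le> M" and bd: "\<And>t y. t \<in> {0..T} \<Longrightarrow> norm (U t y) \<le> M * norm y"
    using C0_semigroup_locally_bounded[OF U] by blast
  define C where "C = T * exp (\<alpha> * T) * M"
  have C: "0 \<le> C" using T M by (simp add: C_def)
  let ?L = "lebesgue_on {0<..<T}"
  define J where "J = (LINT s|?L. U (T - s) (F s))"
  define N where "N = (LINT s|?L. n s)"
  have n0: "0 \<le> n s" for s using norm_ge_zero Fn order_trans by blast
  have N: "0 \<le> N" unfolding N_def by (rule Bochner_Integration.integral_nonneg) (rule n0)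
  have J: "U T z0 = - J" using duhamel zT by (simp add: J_def eq_neg_iff_add_eq_0)
  have "\<bar>z0 \<bullet> \<Psi>\<bar> \<le> (C * norm z0 + exp (\<alpha> * T) * (N * (1 + C))) * (norm Q + q)"
    if adj: "\<forall>(z, w)\<in>A. w \<bullet> \<Psi> = z \<bullet> (- \<alpha> *\<^sub>R \<Psi> + Q)"
      and Fq: "\<And>s. \<bar>F s \<bullet> \<Psi>\<bar> \<le> n s * q" and q: "0 \<le> q" for \<Psi> Q q
  proof -
    have adj': "w \<bullet> \<Psi> = z \<bullet> (- \<alpha> *\<^sub>R \<Psi> + Q)" if "(z, w) \<in> generator U" for z w
      using bspec[OF adj that[unfolded gen]] by simp
    have est: "\<bar>exp (\<alpha> * t) * (U t y \<bullet> \<Psi>) - y \<bullet> \<Psi>\<bar> \<le> C * norm y * norm Q" if "t \<in> {0..T}" for t y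
      unfolding C_def by (rule C0_semigroup_approx_eigenvector[OF U adj' bd \<alpha> that])
    have pt: "\<bar>U (T - s) (F s) \<bullet> \<Psi>\<bar> \<le> n s * ((1 + C) * (norm Q + q))" if "s \<in> {0<..<T}" for s
    proof -
      let ?p = "U (T - s) (F s) \<bullet> \<Psi>"
      have "1 \<le> exp (\<alpha> * (T - s))" using that \<alpha> by simp
      then have "1 * \<bar>?p\<bar> \<le> exp (\<alpha> * (T - s)) * \<bar>?p\<bar>" by (intro mult_right_mono) auto
      then have "\<bar>?p\<bar> \<le> \<bar>exp (\<alpha> * (T - s)) * ?p\<bar>" by (simp add: abs_mult)
      also have "\<dots> \<le> C * norm (F s) * norm Q + \<bar>F s \<bullet> \<Psi>\<bar>"
        using est[of "T - s" "F s"] that by simp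
      also have "\<dots> \<le> C * n s * norm Q + n s * q"
        using Fn[of s] Fq[of s] C by (intro add_mono mult_right_mono mult_left_mono) auto
      also have "\<dots> \<le> n s * ((1 + C) * (norm Q + q))"
      proof -
        have "0 \<le> n s * norm Q + C * n s * q" using n0[of s] C q by simp
        then show ?thesis by (simp add: algebra_simps)
      qed
      finally show ?thesis .
    qed
    have "\<bar>J \<bullet> \<Psi>\<bar> \<le> N * ((1 + C) * (norm Q + q))"
    proof (cases "integrable ?L (\<lambda>s. U (T - s) (F s))")
      case True
      then have "J \<bullet> \<Psi> = (LINT s|?L. U (T - s) (F s) \<bullet> \<Psi>)"
        unfolding J_def by simp
      also have "norm \<dots> \<le> (LINT s|?L. n s * ((1 + C) * (norm Q + q)))"
        using True n pt
        by (intro Bochner_Integration.integral_norm_bound_integral) auto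
      finally show ?thesis by (simp add: N_def)
    next
      \<comment> \<open>A non-integrable Bochner integral has the default value 0, so the bound
        holds here too and integrability need not be established.\<close>
      case False
      then have "J = 0" unfolding J_def by (rule not_integrable_integral_eq)
      then show ?thesis using N C q by simp
    qed
    then have "exp (\<alpha> * T) * \<bar>J \<bullet> \<Psi>\<bar> \<le> exp (\<alpha> * T) * (N * ((1 + C) * (norm Q + q)))"
      by (intro mult_left_mono) auto
    moreover have "\<bar>z0 \<bullet> \<Psi>\<bar> \<le> C * norm z0 * norm Q + exp (\<alpha> * T) * \<bar>J \<bullet> \<Psi>\<bar>"
    proof -
      have "exp (\<alpha> * T) * \<bar>J \<bullet> \<Psi>\<bar> = \<bar>exp (\<alpha> * T) * (U T z0 \<bullet> \<Psi>)\<bar>"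
        by (simp only: J inner_minus_left abs_mult abs_minus_cancel abs_exp_cancel)
      then show ?thesis using est[of T z0] T by simp
    qed
    moreover have "C * norm z0 * norm Q \<le> C * norm z0 * (norm Q + q)"
      using C q by (intro mult_left_mono) auto
    ultimately have "\<bar>z0 \<bullet> \<Psi>\<bar> \<le> C * norm z0 * (norm Q + q)
        + exp (\<alpha> * T) * (N * ((1 + C) * (norm Q + q)))" by linarith
    then show ?thesis by (simp only: distrib_right mult.assoc)
  qed
  moreover have "0 \<le> C * norm z0 + exp (\<alpha> * T) * (N * (1 + C))" using C N by simp
  ultimately show ?thesis by blast
qed

section \<open>Test functions and pairings in L2\<close>

lemma has_real_derivative_max_0_squared:
  "((\<lambda>y::real. (max 0 y)\<^sup>2) has_real_derivative 2 * max 0 y) (at y)"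
proof (cases y "0::real" rule: linorder_cases)
  case less
  have "((\<lambda>y::real. 0) has_real_derivative 2 * max 0 y) (at y)"
    using less by (auto intro!: derivative_eq_intros)
  then show ?thesis
    by (rule has_field_derivative_transform_within_open[of _ _ _ "{..<0}"]) (use less in auto)
next
  case greater
  have "((\<lambda>y::real. y\<^sup>2) has_real_derivative 2 * max 0 y) (at y)"
    using greater by (auto intro!: derivative_eq_intros)
  then show ?thesis
    by (rule has_field_derivative_transform_within_open[of _ _ _ "{0<..}"]) (use greater in auto)
next
  \<comment> \<open>Where the two branches meet, the difference quotient is at most \<bar>h\<bar>.
    The square thus turns a positive part into a C1 function, as test functions require.\<close>
  case equal
  have "((\<lambda>h::real. (max 0 h)\<^sup>2 / h) \<longlongrightarrow> 0) (at 0)"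
  proof (rule Lim_null_comparison)
    show "\<forall>\<^sub>F h::real in at 0. norm ((max 0 h)\<^sup>2 / h) \<le> \<bar>h\<bar>"
      by (rule eventually_at_filter[THEN iffD2], rule always_eventually)
        (auto simp: max_def power2_eq_square)
    show "((\<lambda>h::real. \<bar>h\<bar>) \<longlongrightarrow> 0) (at 0)"
      using tendsto_rabs_zero[OF tendsto_ident_at] by simp
  qed
  then show ?thesis using equal by (simp add: DERIV_def)
qed

lemma square_integrable_of_real:
  fixes g :: "real \<Rightarrow> real"
  assumes "continuous_on UNIV g" "\<And>x. \<bar>g x\<bar> \<le> B"
  shows "square_integrable (\<lambda>x. of_real (g x))"
proof (rule square_integrable_bounded)
  have "(\<lambda>x. complex_of_real (g x)) \<in> borel_measurable borel"
    by (intro borel_measurable_continuous_onI continuous_intros assms)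
  then show "(\<lambda>x. complex_of_real (g x)) \<in> borel_measurable lebOm"
    by (intro measurable_restrict_space1) (simp add: measurable_completion)
  show "cmod (of_real (g x)) \<le> B" for x using assms(2)[of x] by simp
qed

text \<open>Point evaluation is not bounded by the L2 norm: the squared positive part of a parabola
  keeps height 1 at \<open>c\<close> while its support, of length \<open>2 * d\<close>, shrinks. The
  derivative is merely bounded, by \<open>4 / d\<close>.\<close>

lemma exists_narrow_bump:
  assumes W: "open W" "c \<in> W" "W \<subseteq> Om" and \<epsilon>: "0 < \<epsilon>"
  obtains G G' :: "real \<Rightarrow> real" and K B where
    "\<And>x. (G has_real_derivative G' x) (at x)" "continuous_on UNIV G'"
    "compact K" "K \<subseteq> W" "\<And>x. x \<notin> K \<Longrightarrow> G x = 0" "\<And>x. x \<notin> K \<Longrightarrow> G' x = 0"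
    "\<And>x. \<bar>G x\<bar> \<le> B" "\<And>x. \<bar>G' x\<bar> \<le> B" "G c = 1"
    "norm (abs_L2 (\<lambda>x. of_real (G x))) < \<epsilon>"
proof -
  obtain e where e: "0 < e" "cball c e \<subseteq> W"
    using W open_contains_cball by blast
  \<comment> \<open>The bound \<open>e\<close> keeps the support in \<open>W\<close>; the other one
    makes \<open>sqrt (2 * d)\<close> strictly smaller than \<epsilon>.\<close>
  define d where "d = min e (\<epsilon>\<^sup>2 / 4)"
  have d: "0 < d" "d \<le> e" "2 * d < \<epsilon>\<^sup>2" using e \<epsilon> by (auto simp: d_def min_def)
  define G where "G x = (max 0 (1 - ((x - c) / d)\<^sup>2))\<^sup>2" for x
  define G' where "G' x = 2 * max 0 (1 - ((x - c) / d)\<^sup>2) * (- 2 * (x - c) / d\<^sup>2)" for x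
  have DG: "(G has_real_derivative G' x) (at x)" for x
  proof -
    have inner: "((\<lambda>x. 1 - ((x - c) / d)\<^sup>2) has_real_derivative - 2 * (x - c) / d\<^sup>2) (at x)"
      using d by (auto intro!: derivative_eq_intros simp: power2_eq_square divide_simps)
    show ?thesis
      unfolding G_def G'_def by (rule DERIV_chain2[OF has_real_derivative_max_0_squared inner])
  qed
  have cG': "continuous_on UNIV G'"
    unfolding G'_def by (intro continuous_intros) (use d in auto)
  have out: "max 0 (1 - ((x - c) / d)\<^sup>2) = 0" if "x \<notin> cball c d" for x
  proof -
    have "1 \<le> \<bar>(x - c) / d\<bar>" using that d by (simp add: dist_real_def abs_minus_commute)
    then have "1 \<le> ((x - c) / d)\<^sup>2" using abs_le_square_iff[of 1 "(x - c) / d"] by simp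
    then show ?thesis by simp
  qed
  have le1: "\<bar>max 0 (1 - ((x - c) / d)\<^sup>2)\<bar> \<le> 1" for x by simp
  have G0: "G x = 0" "G' x = 0" if "x \<notin> cball c d" for x
    using out[OF that] by (simp_all add: G_def G'_def)
  have Gle: "\<bar>G x\<bar> \<le> 1" for x
    using power_mono[OF le1, of x 2] by (simp add: G_def power_abs)
  have G'le: "\<bar>G' x\<bar> \<le> 4 / d" for x
  proof (cases "x \<in> cball c d")
    case True
    then have "\<bar>- 2 * (x - c) / d\<^sup>2\<bar> \<le> 2 * d / d\<^sup>2"
      using d by (auto simp: abs_mult dist_real_def abs_minus_commute intro!: divide_right_mono)
    then have *: "\<bar>- 2 * (x - c) / d\<^sup>2\<bar> \<le> 2 / d"
      using d by (simp add: power2_eq_square)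
    have "\<bar>G' x\<bar> = 2 * (\<bar>max 0 (1 - ((x - c) / d)\<^sup>2)\<bar> * \<bar>- 2 * (x - c) / d\<^sup>2\<bar>)"
      by (simp only: G'_def abs_mult abs_numeral mult.assoc)
    also have "\<dots> \<le> 2 * (1 * (2 / d))"
      using d by (intro mult_left_mono mult_mono le1 *) auto
    finally show ?thesis by simp
  qed (use G0 d in auto)
  have sG: "square_integrable (\<lambda>x. of_real (G x))"
    using DG Gle by (intro square_integrable_of_real) (auto intro: DERIV_continuous_on)
  have sub: "cball c d \<subseteq> Om" using e d W by (meson order_trans subset_cball)
  have "(LINT x|lebOm. (cmod (of_real (G x)))\<^sup>2) \<le> (LINT x|lebOm. indicator (cball c d) x)"
  proof (rule integral_mono)
    show "integrable lebOm (\<lambda>x. (cmod (complex_of_real (G x)))\<^sup>2)"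
      using sG by (simp add: square_integrable_def)
    show "integrable lebOm (\<lambda>x. indicator (cball c d) x :: real)"
      using finite_measure.emeasure_finite[OF finite_measure_lebOm]
      by (intro integrable_real_indicator)
        (use sub in \<open>auto simp: sets_restrict_space_iff less_top[symmetric]\<close>)
    show "(cmod (complex_of_real (G x)))\<^sup>2 \<le> indicator (cball c d) x" for x
      using G0(1)[of x] power_mono[OF Gle, of x 2] by (auto simp: indicator_def)
  qed
  also have "\<dots> = 2 * d"
  proof -
    have "(LINT x|lebOm. indicator (cball c d) x) = measure lebOm (cball c d)"
      using sub by (simp add: Int_absorb2)
    also have "\<dots> = measure lebesgue (cball c d)"
      using sub by (intro measure_restrict_space) auto
    finally show ?thesis using d by (simp add: cball_eq_atLeastAtMost)
  qed
  finally have "norm (abs_L2 (\<lambda>x. of_real (G x))) \<le> sqrt (2 * d)"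
    unfolding norm_abs_L2[OF sG] by simp
  also have "\<dots> < sqrt (\<epsilon>\<^sup>2)" using d by (intro real_sqrt_less_mono)
  finally have small: "norm (abs_L2 (\<lambda>x. of_real (G x))) < \<epsilon>" using \<epsilon> by simp
  show ?thesis
  proof (rule that[of G G' "cball c d" "max 1 (4 / d)"])
    show "cball c d \<subseteq> W" using e d by (meson order_trans subset_cball)
    show "\<bar>G x\<bar> \<le> max 1 (4 / d)" "\<bar>G' x\<bar> \<le> max 1 (4 / d)" for x
      using Gle[of x] G'le[of x] by auto
    show "G c = 1" by (simp add: G_def)
  qed (use DG cG' G0 small in auto)
qed

section \<open>Integration by parts against real test functions\<close>

lemma has_vector_derivative_of_real_complex:
  assumes "(G has_real_derivative G' x) (at x)"
  shows "((\<lambda>x. complex_of_real (G x)) has_vector_derivative of_real (G' x)) (at x)"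
  by (rule bounded_linear.has_vector_derivative[OF bounded_linear_of_real])
    (use assms in \<open>simp add: has_real_derivative_iff_has_vector_derivative\<close>)

lemma test_function_of_real:
  assumes "\<And>x. (G has_real_derivative G' x) (at x)" "continuous_on UNIV G'"
    "compact K" "K \<subseteq> Om" "\<And>x. x \<notin> K \<Longrightarrow> G x = 0"
  shows "test_function (\<lambda>x. of_real (G x))"
  unfolding test_function_def C1_differentiable_on_def
proof (intro conjI exI[of _ "\<lambda>x. of_real (G' x)"] exI[of _ K] ballI allI impI)
  show "((\<lambda>x. complex_of_real (G x)) has_vector_derivative of_real (G' x)) (at x)" for x
    by (rule has_vector_derivative_of_real_complex[OF assms(1)])
  show "continuous_on UNIV (\<lambda>x. complex_of_real (G' x))"
    by (intro continuous_on_of_real assms)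
qed (simp_all add: assms)

lemma inner_abs_L2:
  assumes "square_integrable f" "square_integrable g"
  shows "abs_L2 f \<bullet> abs_L2 g = (LINT x|lebOm. f x \<bullet> g x)"
  using assms by (intro inner_L2.abs_eq) auto

text \<open>The inner product on \<open>L2\<close> is the real part of the Hermitian one, while weak
  derivatives use the bilinear pairing. For a real second factor the conjugation disappears, which
  links the two.\<close>

lemma inner_abs_L2_of_real:
  assumes "square_integrable (\<lambda>x. of_real (g x))"
  shows "f \<bullet> abs_L2 (\<lambda>x. of_real (g x)) = Re (LINT x|lebOm. rep_L2 f x * of_real (g x))"
proof -
  have "f \<bullet> abs_L2 (\<lambda>x. of_real (g x)) = (LINT x|lebOm. rep_L2 f x \<bullet> of_real (g x))"
    using inner_abs_L2[OF square_integrable_rep assms, of f] by simp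
  also have "\<dots> = (LINT x|lebOm. Re (rep_L2 f x * of_real (g x)))"
    by (simp add: inner_complex_def)
  also have "\<dots> = Re (LINT x|lebOm. rep_L2 f x * of_real (g x))"
    by (rule integral_Re[OF integrable_mult_square[OF square_integrable_rep assms]])
  finally show ?thesis .
qed

lemma inner_weak_derivative:
  assumes w: "has_weak_derivative f g" and t: "test_function (\<lambda>x. of_real (G x))"
    and d: "\<And>x. (G has_real_derivative G' x) (at x)"
    and "square_integrable (\<lambda>x. of_real (G x))" "square_integrable (\<lambda>x. of_real (G' x))"
  shows "g \<bullet> abs_L2 (\<lambda>x. of_real (G x)) = - (f \<bullet> abs_L2 (\<lambda>x. of_real (G' x)))"
proof -
  have "vector_derivative (\<lambda>x. complex_of_real (G x)) (at x) = of_real (G' x)" for x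
    by (rule vector_derivative_at[OF has_vector_derivative_of_real_complex[OF d]])
  moreover have "(LINT x|lebOm. rep_L2 f x * vector_derivative (\<lambda>x. complex_of_real (G x)) (at x))
      = - (LINT x|lebOm. rep_L2 g x * of_real (G x))"
    using w t unfolding has_weak_derivative_def by blast
  ultimately have "(LINT x|lebOm. rep_L2 f x * of_real (G' x)) = - (LINT x|lebOm. rep_L2 g x * of_real (G x))"
    by (simp only:)
  then show ?thesis
    by (simp add: inner_abs_L2_of_real[OF assms(4)] inner_abs_L2_of_real[OF assms(5)])
qed

section \<open>Pairings with cutoffs and with a jump\<close>

lemma square_integrable_cutoff:
  assumes "A \<in> sets lebesgue"
  shows "square_integrable (\<lambda>x. indicator A x *\<^sub>R rep_L2 f x)"
proof (rule square_integrable_bound[OF square_integrable_rep[of f]])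
  have "(indicator A :: real \<Rightarrow> real) \<in> borel_measurable lebOm"
    using assms by (intro measurable_restrict_space1 borel_measurable_indicator)
  then show "(\<lambda>x. indicator A x *\<^sub>R rep_L2 f x) \<in> borel_measurable lebOm"
    using square_integrable_rep[of f] unfolding square_integrable_def
    by (intro borel_measurable_scaleR) auto
qed (auto simp: indicator_def)

lemma norm_cutoff_le:
  assumes "A \<in> sets lebesgue"
  shows "norm (cutoff A f) \<le> norm f"
  unfolding cutoff_def norm_abs_L2[OF square_integrable_cutoff[OF assms]] norm_L2_rep[of f]
  using square_integrable_cutoff[OF assms, of f] square_integrable_rep[of f]
  by (intro real_sqrt_le_mono integral_mono) (auto simp: square_integrable_def indicator_def)

lemma inner_cutoff_eq_0:
  assumes "A \<in> sets lebesgue" "square_integrable g" "\<And>x. x \<in> A \<Longrightarrow> g x = 0"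
  shows "cutoff A f \<bullet> abs_L2 g = 0"
proof -
  have "(\<lambda>x. (indicator A x *\<^sub>R rep_L2 f x) \<bullet> g x) = (\<lambda>x. 0)"
  proof
    show "(indicator A x *\<^sub>R rep_L2 f x) \<bullet> g x = 0" for x
      using assms(3)[of x] by (cases "x \<in> A") auto
  qed
  then show ?thesis
    unfolding cutoff_def inner_abs_L2[OF square_integrable_cutoff[OF assms(1)] assms(2)]
    by (simp only: Bochner_Integration.integral_zero)
qed

text \<open>The weak derivative of the step is minus the Dirac mass at \<open>c\<close>, so pairing
  the step with a derivative evaluates at the jump.\<close>

lemma inner_indicator_derivative:
  assumes G: "\<And>x. (G has_real_derivative G' x) (at x)" and G0: "G 0 = 0"
    and sG': "square_integrable (\<lambda>x. of_real (G' x))" and c: "c \<in> Om"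
  shows "abs_L2 (\<lambda>x. indicator {..<c} x *\<^sub>R 1) \<bullet> abs_L2 (\<lambda>x. of_real (G' x)) = G c"
proof -
  let ?f = "\<lambda>x. (indicator {..<c} x *\<^sub>R 1) \<bullet> complex_of_real (G' x)"
  have si: "square_integrable (\<lambda>x. indicator {..<c} x *\<^sub>R 1)"
    by (rule square_integrable_indicator) simp
  have "(G' has_integral G c - G 0) {0..c}"
    using c G by (intro fundamental_theorem_of_calculus)
      (auto simp: has_real_derivative_iff_has_vector_derivative[symmetric] intro: has_field_derivative_at_within)
  then have "((\<lambda>x. if x \<in> {0..c} then G' x else 0) has_integral G c) UNIV"
    by (simp only: has_integral_restrict_UNIV G0 diff_0_right)
  \<comment> \<open>The integrands differ at most at 0, which is not in \<open>Om\<close>, and at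
    \<open>c\<close>, which is not in \<open>{..<c}\<close>.\<close>
  then have "((\<lambda>x. if x \<in> Om then ?f x else 0) has_integral G c) UNIV"
    by (rule has_integral_spike_finite[of "{0, c}", rotated 2]) (use c in \<open>auto simp: indicator_def\<close>)
  then have "(?f has_integral G c) Om"
    by (simp only: has_integral_restrict_UNIV)
  then show ?thesis
    unfolding inner_abs_L2[OF si sG']
    using lebesgue_integral_eq_integral[OF integrable_inner_square[OF si sG']]
    by (simp add: integral_unique)
qed

section \<open>The control system\<close>

text \<open>Supplies the integrable majorant of the forcing for \<open>null_solution_bound\<close>;
  on a bounded time interval square integrability suffices.\<close>

lemma integrable_norm_L2_controls:
  assumes "f \<in> L2_controls T A"
  shows "integrable (lebesgue_on {0<..<T}) (\<lambda>t. norm (f t))"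
proof (rule Bochner_Integration.integrable_bound)
  have "emeasure lborel {0<..<T} < \<infinity>"
    using emeasure_bounded_finite[of "{0<..<T}"] bounded_box[of 0 T] by simp
  then have "finite_measure (lebesgue_on {0<..<T})"
    by (intro finite_measureI) (simp add: emeasure_restrict_space)
  then show "integrable (lebesgue_on {0<..<T}) (\<lambda>t. 1 + (norm (f t))\<^sup>2)"
    using assms unfolding L2_controls_def
    by (intro Bochner_Integration.integrable_add finite_measure.integrable_const) auto
  show "(\<lambda>t. norm (f t)) \<in> borel_measurable (lebesgue_on {0<..<T})"
    using assms unfolding L2_controls_def by auto
  have "norm (f t) \<le> 1 + (norm (f t))\<^sup>2" for t
  proof -
    have "2 * norm (f t) \<le> (norm (f t))\<^sup>2 + 1"
      using sum_squares_bound[of "norm (f t)" 1] by simp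
    then show ?thesis using norm_ge_zero[of "f t"] by linarith
  qed
  then show "AE t in lebesgue_on {0<..<T}. norm (norm (f t)) \<le> norm (1 + (norm (f t))\<^sup>2)"
    by simp
qed

text \<open>The weights \<open>\<mu> / \<kappa>\<close> and \<open>\<rho>s\<close> make the two
  \<open>u'\<close> terms cancel, so only the stress combination is integrated by parts. The
  conditions on \<open>c\<close> and \<alpha> match the coefficients of
  \<open>\<rho> \<bullet> g'\<close> and \<open>S \<bullet> g'\<close>; the last summand removes the
  pairing of \<open>u\<close> with \<open>g\<close>.\<close>

lemma system_op_adjoint:
  fixes a \<gamma> \<rho>s \<mu> \<kappa> \<alpha> c :: real and g g' :: L2
  defines "b \<equiv> a * \<gamma> * \<rho>s powr (\<gamma> - 2)"
  assumes zw: "(z, w) \<in> system_op a \<gamma> \<rho>s \<mu> \<kappa>"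
    and parts: "\<And>f f'. has_weak_derivative f f' \<Longrightarrow> f' \<bullet> g = - (f \<bullet> g')"
    and c: "c * b = - \<alpha> * \<mu> / \<kappa>" and \<alpha>: "c / \<rho>s + \<rho>s / \<kappa> = \<alpha> * \<rho>s"
  shows "w \<bullet> ((\<mu> / \<kappa>) *\<^sub>R g', c *\<^sub>R g, \<rho>s *\<^sub>R g')
    = z \<bullet> (- \<alpha> *\<^sub>R ((\<mu> / \<kappa>) *\<^sub>R g', c *\<^sub>R g, \<rho>s *\<^sub>R g') + (0, (\<alpha> * c) *\<^sub>R g, 0))"
proof -
  obtain \<rho> u S u' \<sigma>' where z: "z = (\<rho>, u, S)"
    and w: "w = (- \<rho>s *\<^sub>R u', \<sigma>', (\<mu> / \<kappa>) *\<^sub>R u' - (1 / \<kappa>) *\<^sub>R S)"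
    and d: "has_weak_derivative (- b *\<^sub>R \<rho> + (1 / \<rho>s) *\<^sub>R S) \<sigma>'"
    using zw unfolding system_op_def b_def Let_def by blast
  have \<sigma>: "\<sigma>' \<bullet> g = b * (\<rho> \<bullet> g') - (S \<bullet> g') / \<rho>s"
    using parts[OF d] by (simp add: inner_add_left inner_diff_left)
  have "w \<bullet> ((\<mu> / \<kappa>) *\<^sub>R g', c *\<^sub>R g, \<rho>s *\<^sub>R g')
      = (c * b) * (\<rho> \<bullet> g') - (c / \<rho>s + \<rho>s / \<kappa>) * (S \<bullet> g')"
    unfolding w by (simp add: \<sigma> inner_diff_left inner_minus_left algebra_simps)
  also have "\<dots> = (- \<alpha> * \<mu> / \<kappa>) * (\<rho> \<bullet> g') - (\<alpha> * \<rho>s) * (S \<bullet> g')"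
    by (simp only: c \<alpha>)
  also have "\<dots> = z \<bullet> (- \<alpha> *\<^sub>R ((\<mu> / \<kappa>) *\<^sub>R g', c *\<^sub>R g, \<rho>s *\<^sub>R g') + (0, (\<alpha> * c) *\<^sub>R g, 0))"
    unfolding z by (simp add: inner_add_right inner_minus_right algebra_simps)
  finally show ?thesis .
qed

theorem theorem1p4:
  fixes a \<gamma> \<rho>s \<mu> \<kappa> T :: real and O1 O2 O3 :: "real set"
  assumes "a > 0" and "\<gamma> \<ge> 1" and "\<rho>s > 0" and "\<mu> > 0" and "\<kappa> > 0"
    and "open O1" and "O1 \<subset> {0<..<pi}"
    and "open O2" and "O2 \<subseteq> {0<..<pi}"
    and "open O3" and "O3 \<subset> {0<..<pi}"
    and "open ({0<..<pi} - closure (O1 \<union> O3))"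
    and "{0<..<pi} - closure (O1 \<union> O3) \<noteq> {}"
    and "T > 0"
  shows "\<not> null_controllable a \<gamma> \<rho>s \<mu> \<kappa> O1 O2 O3 T"
proof
  assume nc: "null_controllable a \<gamma> \<rho>s \<mu> \<kappa> O1 O2 O3 T"
  define W where "W = {0<..<pi} - closure (O1 \<union> O3)"
  have W: "open W" "W \<subseteq> Om" "W \<inter> O1 = {}" "W \<inter> O3 = {}"
    using assms(12) closure_subset[of "O1 \<union> O3"] by (auto simp: W_def)
  obtain x0 where x0: "x0 \<in> W" using assms(13) unfolding W_def by blast
  define b where "b = a * \<gamma> * \<rho>s powr (\<gamma> - 2)"
  have b: "0 < b" using assms by (simp add: b_def)
  \<comment> \<open>Solution of \<open>c1\<close> and \<open>c2\<close>: the first expresses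
    \<open>c\<close> through \<alpha>, and inserting this into the second leaves a linear equation
    for \<alpha>.\<close>
  define \<alpha> where "\<alpha> = \<rho>s\<^sup>2 * b / (\<kappa> * \<rho>s\<^sup>2 * b + \<mu>)"
  define c where "c = - \<alpha> * \<mu> / (\<kappa> * b)"
  have den: "0 < \<kappa> * \<rho>s\<^sup>2 * b + \<mu>" using assms b by (simp add: add_pos_pos)
  have \<alpha>0: "0 < \<alpha>" unfolding \<alpha>_def using assms b den by simp
  have c1: "c * b = - \<alpha> * \<mu> / \<kappa>" using b by (simp add: c_def)
  have "\<alpha> * (\<kappa> * \<rho>s\<^sup>2 * b + \<mu>) = \<rho>s\<^sup>2 * b" using den by (simp add: \<alpha>_def)
  then have c2: "c / \<rho>s + \<rho>s / \<kappa> = \<alpha> * \<rho>s"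
    using assms(3,5) b by (simp add: c_def field_simps power2_eq_square)
  have leb: "O1 \<in> sets lebesgue" "O2 \<in> sets lebesgue" "O3 \<in> sets lebesgue"
    using assms by auto
  define \<rho>0 where "\<rho>0 = abs_L2 (\<lambda>x. indicator {..<x0} x *\<^sub>R 1)"
  obtain f1 f2 f3 z where f: "f1 \<in> L2_controls T O1" "f2 \<in> L2_controls T O2" "f3 \<in> L2_controls T O3"
    and mild: "mild_solution (system_op a \<gamma> \<rho>s \<mu> \<kappa>) T (\<rho>0, 0, 0)
          (\<lambda>t. (cutoff O1 (f1 t), cutoff O2 (f2 t), cutoff O3 (f3 t))) z"
    and zT: "z T = 0"
    using nc unfolding null_controllable_def zero_prod_def by meson
  let ?F = "\<lambda>t. (cutoff O1 (f1 t), cutoff O2 (f2 t), cutoff O3 (f3 t))"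
  let ?n = "\<lambda>t. norm (f1 t) + (norm (f2 t) + norm (f3 t))"
  have n: "integrable (lebesgue_on {0<..<T}) ?n"
    by (intro Bochner_Integration.integrable_add) (rule integrable_norm_L2_controls[OF f(1)]
        integrable_norm_L2_controls[OF f(2)] integrable_norm_L2_controls[OF f(3)])+
  have Fn: "norm (?F t) \<le> ?n t" for t
    by (intro order_trans[OF norm_Pair_le] add_mono norm_cutoff_le leb)
  obtain K where K: "0 \<le> K" and bound: "\<And>\<Psi> Q q. (\<forall>(z, w)\<in>system_op a \<gamma> \<rho>s \<mu> \<kappa>.
      w \<bullet> \<Psi> = z \<bullet> (- \<alpha> *\<^sub>R \<Psi> + Q)) \<Longrightarrow> (\<forall>s. \<bar>?F s \<bullet> \<Psi>\<bar> \<le> ?n s * q) \<Longrightarrow> 0 \<le> q \<Longrightarrow>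
      \<bar>(\<rho>0, 0, 0) \<bullet> \<Psi>\<bar> \<le> K * (norm Q + q)"
    using null_solution_bound[OF mild zT assms(14) less_imp_le[OF \<alpha>0] n Fn] by blast
  \<comment> \<open>For \<open>norm Q = \<alpha> * \<bar>c\<bar> * norm g\<close> and
    \<open>q = \<bar>c\<bar> * norm g\<close> the bound becomes \<open>R * norm g\<close>. As
    \<open>K\<close> is fixed before the bump, \<epsilon> may depend on it; \<open>R + 1\<close>
    keeps the denominator positive.\<close>
  define R where "R = K * ((\<alpha> + 1) * \<bar>c\<bar>)"
  have R: "0 \<le> R" using K \<alpha>0 by (simp add: R_def)
  define \<epsilon> where "\<epsilon> = (\<mu> / \<kappa>) / (R + 1)"
  have \<epsilon>: "0 < \<epsilon>" using R assms by (simp add: \<epsilon>_def)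
  obtain G G' :: "real \<Rightarrow> real" and X B where
    G: "\<And>x. (G has_real_derivative G' x) (at x)" and G': "continuous_on UNIV G'"
    and X: "compact X" "X \<subseteq> W" "\<And>x. x \<notin> X \<Longrightarrow> G x = 0" "\<And>x. x \<notin> X \<Longrightarrow> G' x = 0"
    and B: "\<And>x. \<bar>G x\<bar> \<le> B" "\<And>x. \<bar>G' x\<bar> \<le> B" and G1: "G x0 = 1"
    and small: "norm (abs_L2 (\<lambda>x. of_real (G x))) < \<epsilon>"
    using exists_narrow_bump[OF W(1) x0 W(2) \<epsilon>] by metis
  let ?g = "abs_L2 (\<lambda>x. of_real (G x))" and ?g' = "abs_L2 (\<lambda>x. of_real (G' x))"
  have sG: "square_integrable (\<lambda>x. of_real (G x))"
    by (rule square_integrable_of_real[OF DERIV_continuous_on B(1)]) (rule G[THEN has_field_derivative_at_within])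
  have sG': "square_integrable (\<lambda>x. of_real (G' x))"
    by (rule square_integrable_of_real[OF G' B(2)])
  have tG: "test_function (\<lambda>x. of_real (G x))"
    by (rule test_function_of_real[OF G G' X(1) order_trans[OF X(2) W(2)] X(3)])
  let ?\<Psi> = "((\<mu> / \<kappa>) *\<^sub>R ?g', c *\<^sub>R ?g, \<rho>s *\<^sub>R ?g')" and ?Q = "(0::L2, (\<alpha> * c) *\<^sub>R ?g, 0::L2)"
  have "\<bar>(\<rho>0, 0, 0) \<bullet> ?\<Psi>\<bar> \<le> K * (norm ?Q + \<bar>c\<bar> * norm ?g)"
  proof (rule bound)
    have "w \<bullet> ?\<Psi> = z \<bullet> (- \<alpha> *\<^sub>R ?\<Psi> + ?Q)" if "(z, w) \<in> system_op a \<gamma> \<rho>s \<mu> \<kappa>" for z w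
      by (rule system_op_adjoint[OF that inner_weak_derivative[OF _ tG G sG sG']])
        (use c1 c2 in \<open>simp_all add: b_def\<close>)
    then show "\<forall>(z, w)\<in>system_op a \<gamma> \<rho>s \<mu> \<kappa>. w \<bullet> ?\<Psi> = z \<bullet> (- \<alpha> *\<^sub>R ?\<Psi> + ?Q)"
      by blast
    show "\<forall>s. \<bar>?F s \<bullet> ?\<Psi>\<bar> \<le> ?n s * (\<bar>c\<bar> * norm ?g)"
    proof
      fix s
      have z: "G' x = 0" if "x \<in> O1 \<union> O3" for x
        using that X(2) X(4)[of x] W(3,4) by blast
      have "cutoff O1 (f1 s) \<bullet> ?g' = 0" "cutoff O3 (f3 s) \<bullet> ?g' = 0"
        by (rule inner_cutoff_eq_0[OF leb(1) sG'], use z in simp,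
            rule inner_cutoff_eq_0[OF leb(3) sG'], use z in simp)
      then have "\<bar>?F s \<bullet> ?\<Psi>\<bar> = \<bar>c\<bar> * \<bar>cutoff O2 (f2 s) \<bullet> ?g\<bar>"
        by (simp add: abs_mult)
      also have "\<dots> \<le> \<bar>c\<bar> * (norm (cutoff O2 (f2 s)) * norm ?g)"
        by (intro mult_left_mono Cauchy_Schwarz_ineq2) simp
      also have "\<dots> \<le> \<bar>c\<bar> * (?n s * norm ?g)"
      proof -
        have "norm (cutoff O2 (f2 s)) \<le> ?n s"
          using norm_cutoff_le[OF leb(2), of "f2 s"]
            norm_ge_zero[of "f1 s"] norm_ge_zero[of "f3 s"] by linarith
        then show ?thesis by (intro mult_left_mono mult_right_mono) auto
      qed
      finally show "\<bar>?F s \<bullet> ?\<Psi>\<bar> \<le> ?n s * (\<bar>c\<bar> * norm ?g)" by (simp add: mult_ac)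
    qed
  qed simp
  also have "norm ?Q = \<alpha> * \<bar>c\<bar> * norm ?g"
    using \<alpha>0 by (simp add: norm_Pair abs_mult)
  also have "K * (\<alpha> * \<bar>c\<bar> * norm ?g + \<bar>c\<bar> * norm ?g) = R * norm ?g"
    by (simp add: R_def algebra_simps)
  also have "\<dots> \<le> R * \<epsilon>" using small R by (intro mult_left_mono) auto
  also have "\<dots> < \<mu> / \<kappa>"
  proof -
    have "\<epsilon> * (R + 1) = \<mu> / \<kappa>" using R by (simp add: \<epsilon>_def)
    then show ?thesis using \<epsilon> by (simp add: algebra_simps)
  qed
  finally have "\<bar>(\<rho>0, 0, 0) \<bullet> ?\<Psi>\<bar> < \<mu> / \<kappa>" .
  \<comment> \<open>The jump of the datum picks out \<open>G x0\<close>, so the pairing with the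
    full triple equals \<open>\<mu> / \<kappa>\<close>, which the strict bound excludes.\<close>
  moreover have "\<rho>0 \<bullet> ?g' = 1"
  proof -
    have "G 0 = 0" using X(2) W(2) by (intro X(3)) auto
    then show ?thesis
      unfolding \<rho>0_def using inner_indicator_derivative[OF G _ sG', of x0] x0 W(2) G1 by auto
  qed
  ultimately show False using assms(4,5) by simp
qed

end
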